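(* As $m\to\infty$, the probability measures $\sigma_m$ on $\mathbb{R}$ converge weakly to the centered Gaussian measure $\gamma_2$ of variance $2$.
   Context: For $v\ge 0$, $\gamma_v$ is the centered Gaussian measure on $\mathbb{R}$ with variance $v$, and $\ast$ denotes convolution of finite measures on $\mathbb{R}$. For $t>0$, $\mathcal{R}_t:\mathbb{R}\to\mathbb{R}$ is $x\mapsto tx$ and $(\mathcal{R}_t)_*$ denotes pushforward of measures. For $v>0$ and a positive integer $N$, $\mathrm{GOE}_N^v$ is the space of real symmetric $N\times N$ matrices $A=(a_{ij})$ with the Gaussian measure for which the entries $a_{ij}$, $i\le j$, are independent centered normal variables with $\mathrm{var}(a_{ii})=2v$ and $\mathrm{var}(a_{ij})=v$ for $i<j$. $\rho_{N,v}$ is the function determined by $\int_{\mathbb{R}}f(\lambda)\rho_{N,v}(\lambda)\,d\lambda=\frac1N\mathbb{E}_{\mathrm{GOE}_N^v}(\mathrm{tr} f(A))$ for all bounded continuous $f:\mathbb{R}\to\mathbb{R}$. $\sigma_{m,1}$ is the probability measure on $\mathbb{R}$ proportional to $e^{-\lambda^2/4}\rho_{m+1,1}(\lambda)\,d\lambda$. For each integer $m\ge2$, $\sigma_m$ is the unique probability measure on $\mathbb{R}$ satisfying $$\gamma_{\frac{2}{m+2}}\ast\sigma_m=\Bigl(\mathcal{R}_{\sqrt{\frac{m+4}{m+2}}}\Bigr)_*\sigma_{m,1}.$$ Such a measure exists: for any smooth compact connected Riemannian manifold $(M,g)$ of dimension $m$ and volume $1$, $\sigma_m$ is the weak limit as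 $L\to\infty$ of the probability measures $\frac{1}{N^L}(\mathcal{R}_{1/\sqrt{\dim U^L}})_*\sigma^L$. Here $U^L=\bigoplus_{\lambda\in[0,L^2]}\ker(\lambda-\Delta_g)$ carries the standard Gaussian measure of the $L^2$ inner product, $\sigma^L$ is the expectation of the random measure $\sum_{du(p)=0}\delta_{u(p)}$ for $u\in U^L$ random (almost surely Morse for $L$ large), and $N^L$ is the total mass of $\sigma^L$. *)

theory Defs
  imports "HOL-Probability.Probability" "Jordan_Normal_Form.Jordan_Normal_Form"
begin

text \<open>The case distinction is needed because \<^const>\<open>normal_density\<close> with standard deviation
  zero is the zero function.\<close>

definition gaussian :: "real \<Rightarrow> real measure" where
  "gaussian v = (if v = 0 then return borel 0 else density lborel (normal_density 0 (sqrt v)))"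

text \<open>A real symmetric matrix is given by its entries with \<open>i \<le> j\<close>, indices starting at 0.
  \<open>goe N v\<close> is the Gaussian measure of the orthogonal ensemble in these coordinates, and
  \<open>sym_mat N\<close> is the linear isomorphism from the coordinates to symmetric matrices.\<close>

definition goe :: "nat \<Rightarrow> real \<Rightarrow> (nat \<times> nat \<Rightarrow> real) measure" where
  "goe N v = PiM {(i, j). i \<le> j \<and> j < N} (\<lambda>(i, j). gaussian (if i = j then 2 * v else v))"

definition sym_mat :: "nat \<Rightarrow> (nat \<times> nat \<Rightarrow> real) \<Rightarrow> real mat" where
  "sym_mat N a = Matrix.mat N N (\<lambda>(i, j). a (min i j, max i j))"

text \<open>Functional calculus of a real symmetric matrix: if \<open>A = U diag(d) U\<^sup>T\<close> with \<open>U\<close> orthogonal,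
  then \<open>f(A) = U diag(f(d)) U\<^sup>T\<close>, which does not depend on the diagonalization. The relation
  \<^const>\<open>similar_mat_wit\<close> includes \<open>U U\<^sup>T = U\<^sup>T U = 1\<close>. (The predicate \<^const>\<open>orthogonal_mat\<close> would only
  say that the columns are nonzero and pairwise orthogonal.)\<close>

definition mat_fun :: "(real \<Rightarrow> real) \<Rightarrow> real mat \<Rightarrow> real mat" where
  "mat_fun f A = (THE B. \<exists>U d.
     similar_mat_wit A (mat_diag (dim_row A) d) U (transpose_mat U) \<and>
     B = U * mat_diag (dim_row A) (\<lambda>i. f (d i)) * transpose_mat U)"

definition mat_trace :: "real mat \<Rightarrow> real" where
  "mat_trace A = (\<Sum>i<dim_row A. A $$ (i, i))"

text \<open>The defining relation of the density \<open>\<rho>\<^sub>N\<^sub>,\<^sub>v\<close>, which determines it up to a Lebesgue null set.\<close>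

definition is_goe_density :: "nat \<Rightarrow> real \<Rightarrow> (real \<Rightarrow> real) \<Rightarrow> bool" where
  "is_goe_density N v \<rho> \<longleftrightarrow>
     integrable lborel \<rho> \<and>
     (\<forall>f :: real \<Rightarrow> real. continuous_on UNIV f \<longrightarrow> bounded (range f) \<longrightarrow>
        (\<integral>x. f x * \<rho> x \<partial>lborel) =
        1 / real N * (\<integral>a. mat_trace (mat_fun f (sym_mat N a)) \<partial>goe N v))"

text \<open>The measure \<open>\<sigma>\<^sub>m\<^sub>,\<^sub>1\<close> when \<open>\<rho>\<close> is the density \<open>\<rho>\<^sub>m\<^sub>+\<^sub>1\<^sub>,\<^sub>1\<close>.\<close>

definition sigma_one :: "(real \<Rightarrow> real) \<Rightarrow> real measure" where
  "sigma_one \<rho> = density lborel (\<lambda>x. ennreal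
     (exp (- x\<^sup>2 / 4) * \<rho> x / (\<integral>y. exp (- y\<^sup>2 / 4) * \<rho> y \<partial>lborel)))"

end

theory Submission
  imports Defs "Jordan_Normal_Form.Spectral_Radius" "HOL-Real_Asymp.Real_Asymp"
begin

text \<open>The eigenvalues of a matrix of \<open>GOE\<^sub>N\<^sup>1\<close> fill the interval \<open>[-2\<surd>N, 2\<surd>N]\<close>, with density about
  \<open>\<surd>N/\<pi>\<close> near the origin. The weight \<open>exp (-\<lambda>\<^sup>2/4)\<close> only sees eigenvalues of size \<open>O(1)\<close>, where that
  density is constant. Hence \<open>\<sigma>\<^sub>m\<^sub>,\<^sub>1\<close> converges to the probability measure with density proportional to
  \<open>exp (-\<lambda>\<^sup>2/4)\<close>, which is \<open>\<gamma>\<^sub>2\<close>. The rescaling by \<open>sqrt ((m+4)/(m+2))\<close> and the Gaussian factor of variance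
  \<open>2/(m+2)\<close> disappear in the limit: on the level of characteristic functions, the first is a
  convergent reparametrization and the second is a divisor that tends to 1, and the Levy
  continuity theorem gives the result.

  The point is therefore that \<open>\<surd>N \<rho>\<^sub>N\<^sub>,\<^sub>1\<close> converges to the constant \<open>1/\<pi>\<close> in a sufficiently strong weak sense.
  The global semicircle law says nothing at the scale \<open>O(1)\<close>, which is smaller than the width of the
  spectrum by a factor \<open>\<surd>N\<close>. Fix \<open>z\<close> in the upper half plane and let \<open>G\<close> be the resolvent
  \<open>(A - z)\<^sup>-\<^sup>1\<close> and \<open>X = tr G\<close>. Gaussian integration by parts in the entries of \<open>A\<close> gives
  \<open>E (X\<^sup>2 + z X + N + tr G\<^sup>2) = 0\<close>, in which \<open>X\<^sup>2 + N\<close> is the leading part, so that \<open>X\<close> should be close to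
  \<open>i\<surd>N\<close>. An equation for \<open>E X\<^sup>2\<close> does not determine \<open>E X\<close> as long as the fluctuations of \<open>X\<close> are unknown.
  They are controlled by a second use of the same integration by parts: with the additional factor
  \<open>cnj W\<close>, where \<open>W = X\<^sup>2 + N\<close>, it yields an expression for \<open>E |W|\<^sup>2\<close> (\<open>loop_equation\<close>) whose remaining terms
  are of lower order because \<open>tr |G|\<^sup>2 = Im X / Im z\<close>. This bounds \<open>E |W|\<^sup>2\<close> by a constant
  times \<open>N\<close>. Since \<open>Im X \<ge> 0\<close>, one has \<open>N |X - i\<surd>N|\<^sup>2 \<le> |W|\<^sup>2\<close>, hence \<open>E |X - i\<surd>N|\<close> stays bounded
  (\<open>resolvent_trace_expectation\<close>). The imaginary part says that every Poisson integral of
  \<open>\<surd>N \<rho>\<^sub>N\<^sub>,\<^sub>1\<close> tends to 1 (\<open>goe_poisson_limit\<close>).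

  The passage from Poisson kernels to the functions \<open>exp (i t \<lambda> - \<lambda>\<^sup>2/4)\<close> is a Tauberian argument
  (\<open>tendsto_integral_of_poisson_limits\<close>). Such a function is the limit of its Poisson smoothings in the
  supremum norm with weight \<open>1 + \<lambda>\<^sup>2\<close>, and this norm is the right one since the masses of
  \<open>\<surd>N \<rho>\<^sub>N\<^sub>,\<^sub>1 / (1 + \<lambda>\<^sup>2)\<close> are themselves Poisson integrals, hence bounded.\<close>

section \<open>Diagonalization of real symmetric matrices\<close>

text \<open>An eigenvector exists over the complex numbers. Symmetry of the matrix, applied to the real and
  the imaginary part of that vector, forces the eigenvalue to be real; then both parts satisfy the
  eigenvalue equation, and at least one of them is nonzero.\<close>

lemma symmetric_real_eigenvector:
  fixes A :: "real mat"
  assumes A: "A \<in> carrier_mat n n" and n: "n > 0"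
    and sym: "\<And>i j. i < n \<Longrightarrow> j < n \<Longrightarrow> A $$ (i,j) = A $$ (j,i)"
  shows "\<exists>x \<mu>. (\<Sum>i<n. (x i)\<^sup>2) = (1::real) \<and> (\<forall>i<n. (\<Sum>j<n. A $$ (i,j) * x j) = \<mu> * x i)"
proof -
  let ?C = "map_mat complex_of_real A"
  have C: "?C \<in> carrier_mat n n" using A by simp
  from spectrum_non_empty[OF C] n obtain k where "eigenvalue ?C k"
    unfolding spectrum_def by auto
  then obtain v where v: "v \<in> carrier_vec n" "v \<noteq> 0\<^sub>v n" and ev: "?C *\<^sub>v v = k \<cdot>\<^sub>v v"
    unfolding eigenvalue_def eigenvector_def using A by auto
  define x y where "x i = Re (vec_index v i)" and "y i = Im (vec_index v i)" for i
  define a b where "a = Re k" and "b = Im k"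
  have comp: "(\<Sum>j<n. complex_of_real (A $$ (i,j)) * vec_index v j) = k * vec_index v i" if i: "i < n" for i
  proof -
    have "vec_index (?C *\<^sub>v v) i = vec_index (k \<cdot>\<^sub>v v) i" using ev by simp
    then show ?thesis using i A v(1)
      by (simp add: scalar_prod_def row_def lessThan_atLeast0)
  qed
  have ex: "(\<Sum>j<n. A $$ (i,j) * x j) = a * x i - b * y i" if "i < n" for i
    using arg_cong[OF comp[OF that], of Re] by (simp add: x_def y_def a_def b_def)
  have ey: "(\<Sum>j<n. A $$ (i,j) * y j) = a * y i + b * x i" if "i < n" for i
    using arg_cong[OF comp[OF that], of Im] by (simp add: x_def y_def a_def b_def)
  have "(\<Sum>i<n. x i * (\<Sum>j<n. A $$ (i,j) * y j)) = (\<Sum>j<n. \<Sum>i<n. x i * (A $$ (i,j) * y j))"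
    unfolding sum_distrib_left by (rule sum.swap)
  also have "\<dots> = (\<Sum>j<n. y j * (\<Sum>i<n. A $$ (j,i) * x i))"
    unfolding sum_distrib_left by (intro sum.cong refl) (auto simp: sym)
  finally have "(\<Sum>i<n. x i * (a * y i + b * x i)) = (\<Sum>i<n. y i * (a * x i - b * y i))"
    by (simp add: ex ey)
  then have "(\<Sum>i<n. x i * (a * y i + b * x i) - y i * (a * x i - b * y i)) = 0"
    by (simp add: sum_subtractf)
  then have "b * (\<Sum>i<n. (x i)\<^sup>2 + (y i)\<^sup>2) = 0"
    by (simp add: sum_distrib_left algebra_simps power2_eq_square)
  moreover obtain i0 where i0: "i0 < n" "vec_index v i0 \<noteq> 0"
    using v by (metis carrier_vecD eq_vecI index_zero_vec(1) index_zero_vec(2))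
  have "(\<Sum>i<n. (x i)\<^sup>2 + (y i)\<^sup>2) > 0"
    by (rule sum_pos2[of _ i0]) (use i0 in \<open>auto simp: x_def y_def complex_eq_iff sum_power2_gt_zero_iff\<close>)
  ultimately have b: "b = 0" by auto
  have "\<exists>w. (\<exists>i<n. w i \<noteq> 0) \<and> (\<forall>i<n. (\<Sum>j<n. A $$ (i,j) * w j) = a * w i)"
  proof (cases "x i0 = 0")
    case True
    then have "y i0 \<noteq> 0" using i0 by (auto simp: x_def y_def complex_eq_iff)
    then show ?thesis using ey b i0 by (intro exI[of _ y]) auto
  next
    case False
    then show ?thesis using ex b i0 by (intro exI[of _ x]) auto
  qed
  then obtain w where w: "\<exists>i<n. w i \<noteq> 0" "\<And>i. i < n \<Longrightarrow> (\<Sum>j<n. A $$ (i,j) * w j) = a * w i" by auto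
  define s where "s = (\<Sum>i<n. (w i)\<^sup>2)"
  have s: "s > 0" unfolding s_def using w(1) by (auto intro: sum_pos2)
  have "(\<Sum>i<n. (w i / sqrt s)\<^sup>2) = 1"
    using s by (simp add: power_divide sum_divide_distrib[symmetric] s_def[symmetric])
  moreover have "(\<Sum>j<n. A $$ (i,j) * (w j / sqrt s)) = a * (w i / sqrt s)" if "i < n" for i
    using w(2)[OF that] by (simp add: sum_divide_distrib[symmetric])
  ultimately show ?thesis by (intro exI[of _ "\<lambda>i. w i / sqrt s"] exI[of _ a]) auto
qed

lemma index_mult_mat_sum:
  "A \<in> carrier_mat n m \<Longrightarrow> B \<in> carrier_mat m k \<Longrightarrow> i < n \<Longrightarrow> j < k \<Longrightarrow>
    (A * B) $$ (i,j) = (\<Sum>l<m. A $$ (i,l) * B $$ (l,j))"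
  by (simp add: scalar_prod_def lessThan_atLeast0)

text \<open>The reflection in the hyperplane orthogonal to \<open>v - e\<^sub>n\<close> exchanges the unit vectors \<open>v\<close> and
  \<open>e\<^sub>n\<close>. It extends \<open>v\<close> to an orthonormal basis by an explicit formula. The last basis vector is used,
  so that the induction below splits off the last row and column and keeps the other indices.\<close>

lemma householder_reflection:
  fixes v :: "nat \<Rightarrow> real"
  assumes v: "(\<Sum>i<Suc n. (v i)\<^sup>2) = 1"
  shows "\<exists>H \<in> carrier_mat (Suc n) (Suc n). transpose_mat H = H \<and> H * H = 1\<^sub>m (Suc n) \<and>
           (\<forall>i<Suc n. H $$ (i,n) = v i)"
proof -
  define w where "w i = v i - (if i = n then 1 else 0)" for i
  define s where "s = (\<Sum>i<Suc n. (w i)\<^sup>2)"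
  define H where "H = Matrix.mat (Suc n) (Suc n) (\<lambda>(i,j). (if i = j then 1 else 0) - 2 / s * w i * w j)"
  have s_eq: "s = 2 - 2 * v n"
    using v unfolding s_def w_def by (simp add: power2_eq_square algebra_simps)
  have w0: "w i = 0" if "s = 0" "i < Suc n" for i
    using that unfolding s_def by (subst (asm) sum_nonneg_eq_0_iff) auto
  have "H * H = 1\<^sub>m (Suc n)"
  proof (rule eq_matI)
    fix i j assume ij: "i < dim_row (1\<^sub>m (Suc n))" "j < dim_col (1\<^sub>m (Suc n))"
    have "(H * H) $$ (i,j) = (\<Sum>k<Suc n. ((if i = k then 1 else 0) - 2 / s * w i * w k) *
        ((if k = j then 1 else 0) - 2 / s * w k * w j))"
      using ij by (simp add: H_def scalar_prod_def lessThan_atLeast0 del: sum.op_ivl_Suc sum.lessThan_Suc)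
    also have "\<dots> = (\<Sum>k<Suc n. (if k = i then (if i = j then 1 else 0) else 0)
        - (if k = i then 2 / s * w i * w j else 0) - (if k = j then 2 / s * w i * w j else 0)
        + (2 / s)\<^sup>2 * w i * w j * (w k)\<^sup>2)"
      by (intro sum.cong refl) (auto simp: power2_eq_square algebra_simps)
    also have "\<dots> = (if i = j then 1 else 0) - 2 / s * w i * w j - 2 / s * w i * w j
        + (2 / s)\<^sup>2 * w i * w j * s"
      using ij unfolding sum.distrib sum_subtractf s_def
      by (simp add: sum_distrib_left[symmetric] del: sum.lessThan_Suc)
    also have "\<dots> = (if i = j then 1 else 0)" by (cases "s = 0") (auto simp: power2_eq_square)
    finally show "(H * H) $$ (i,j) = 1\<^sub>m (Suc n) $$ (i,j)" using ij by simp
  qed (auto simp: H_def)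
  moreover have "transpose_mat H = H" by (rule eq_matI) (auto simp: H_def)
  moreover have "H $$ (i,n) = v i" if i: "i < Suc n" for i
  proof (cases "s = 0")
    case True
    then show ?thesis using w0[OF True i] i by (auto simp: H_def w_def)
  next
    case False
    have "2 / s * w i * w n = - w i"
      using False unfolding s_eq w_def[of n] by (simp add: field_simps)
    then show ?thesis using i by (simp add: H_def) (simp add: w_def)
  qed
  ultimately show ?thesis by (intro bexI[of _ H]) (auto simp: H_def)
qed

text \<open>Conjugation with a Householder reflection moves an eigenvector to the last basis vector. The
  conjugated matrix is again symmetric, so it is block diagonal with blocks of sizes \<open>n\<close> and 1, and
  the induction hypothesis applies to the first block.\<close>

lemma spectral_theorem_real:
  fixes A :: "real mat"
  assumes "A \<in> carrier_mat n n"
    and "\<And>i j. i < n \<Longrightarrow> j < n \<Longrightarrow> A $$ (i,j) = A $$ (j,i)"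
  shows "\<exists>U d. similar_mat_wit A (mat_diag n d) U (transpose_mat U)"
  using assms
proof (induction n arbitrary: A)
  case 0
  then show ?case
    by (intro exI[of _ "1\<^sub>m 0"] exI) (auto simp: similar_mat_wit_def Let_def)
next
  case (Suc n)
  let ?N = "Suc n"
  note A = Suc.prems(1)
  obtain v \<mu> where v: "(\<Sum>i<?N. (v i)\<^sup>2) = 1" and ev: "\<And>i. i < ?N \<Longrightarrow> (\<Sum>j<?N. A $$ (i,j) * v j) = \<mu> * v i"
    using symmetric_real_eigenvector[OF Suc.prems(1) _ Suc.prems(2)] by blast
  obtain H where H: "H \<in> carrier_mat ?N ?N" "transpose_mat H = H" "H * H = 1\<^sub>m ?N"
    "\<And>i. i < ?N \<Longrightarrow> H $$ (i,n) = v i"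
    using householder_reflection[OF v] by blast
  have AT: "transpose_mat A = A"
    by (rule eq_matI) (use A Suc.prems(2) in auto)
  define B where "B = H * A * H"
  have B: "B \<in> carrier_mat ?N ?N" using H(1) A by (auto simp: B_def)
  have BT: "transpose_mat B = B"
    using H A AT unfolding B_def
    by (simp add: transpose_mult[of _ ?N ?N _ ?N] assoc_mult_mat[of _ ?N ?N _ ?N _ ?N])
  have Bsym: "B $$ (i,j) = B $$ (j,i)" if "i < ?N" "j < ?N" for i j
    using arg_cong[OF BT, of "\<lambda>M. M $$ (i,j)"] that B by auto
  have AB: "similar_mat_wit A B H H"
  proof -
    have "H * B * H = (H * H) * A * (H * H)"
      using H(1) A unfolding B_def by (simp add: assoc_mult_mat[of _ ?N ?N _ ?N _ ?N])
    then show ?thesis using H A B by (auto simp: similar_mat_wit_def Let_def)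
  qed
  have colB: "B $$ (i,n) = (if i = n then \<mu> else 0)" if i: "i < ?N" for i
  proof -
    have AH: "(A * H) $$ (k,n) = \<mu> * H $$ (k,n)" if "k < ?N" for k
    proof -
      have "(A * H) $$ (k,n) = (\<Sum>j<?N. A $$ (k,j) * H $$ (j,n))"
        using that A H(1) by (simp add: scalar_prod_def lessThan_atLeast0 del: sum.op_ivl_Suc sum.lessThan_Suc)
      also have "\<dots> = (\<Sum>j<?N. A $$ (k,j) * v j)" by (intro sum.cong refl) (auto simp: H(4))
      finally show ?thesis using ev[OF that] H(4)[OF that] by simp
    qed
    have "B $$ (i,n) = (\<Sum>k<?N. H $$ (i,k) * (A * H) $$ (k,n))"
      unfolding B_def assoc_mult_mat[OF H(1) A H(1)]
      by (rule index_mult_mat_sum) (use i A H(1) in auto)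
    also have "\<dots> = \<mu> * (\<Sum>k<?N. H $$ (i,k) * H $$ (k,n))"
      unfolding sum_distrib_left by (intro sum.cong refl) (auto simp: AH)
    also have "(\<Sum>k<?N. H $$ (i,k) * H $$ (k,n)) = (H * H) $$ (i,n)"
      using i H(1) by (simp add: scalar_prod_def lessThan_atLeast0 del: sum.op_ivl_Suc sum.lessThan_Suc)
    finally show ?thesis using i H(3) by auto
  qed
  define B1 where "B1 = Matrix.mat n n (\<lambda>(i,j). B $$ (i,j))"
  define D1 where "D1 = Matrix.mat 1 1 (\<lambda>_. \<mu>)"
  have B1: "B1 \<in> carrier_mat n n" by (simp add: B1_def)
  have D1: "D1 \<in> carrier_mat 1 1" by (simp add: D1_def)
  have Bblock: "B = four_block_mat B1 (0\<^sub>m n 1) (0\<^sub>m 1 n) D1"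
  proof (rule eq_matI)
    fix i j assume "i < dim_row (four_block_mat B1 (0\<^sub>m n 1) (0\<^sub>m 1 n) D1)"
      "j < dim_col (four_block_mat B1 (0\<^sub>m n 1) (0\<^sub>m 1 n) D1)"
    then have ij: "i < ?N" "j < ?N" by (auto simp: B1_def D1_def)
    then show "B $$ (i,j) = four_block_mat B1 (0\<^sub>m n 1) (0\<^sub>m 1 n) D1 $$ (i,j)"
      using colB[OF ij(1)] colB[OF ij(2)] Bsym[OF ij] by (auto simp: B1_def D1_def less_Suc_eq)
  qed (use B in \<open>auto simp: B1_def D1_def\<close>)
  obtain U d where U: "similar_mat_wit B1 (mat_diag n d) U (transpose_mat U)"
    using Suc.IH[OF B1] Bsym by (auto simp: B1_def)
  from similar_mat_witD2[OF B1 U] have Uc: "U \<in> carrier_mat n n" by auto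
  let ?V = "four_block_mat U (0\<^sub>m n 1) (0\<^sub>m 1 n) (1\<^sub>m 1)"
  let ?W = "four_block_mat (transpose_mat U) (0\<^sub>m n 1) (0\<^sub>m 1 n) (1\<^sub>m 1)"
  define e where "e i = (if i < n then d i else \<mu>)" for i
  have De: "four_block_mat (mat_diag n d) (0\<^sub>m n 1) (0\<^sub>m 1 n) D1 = mat_diag ?N e"
    by (rule eq_matI) (auto simp: D1_def mat_diag_def e_def less_Suc_eq)
  have VT: "transpose_mat ?V = ?W"
    by (rule eq_matI) (use Uc in \<open>auto simp: less_Suc_eq\<close>)
  have "similar_mat_wit (four_block_mat B1 (0\<^sub>m n 1) (0\<^sub>m 1 n) D1)
      (four_block_mat (mat_diag n d) (0\<^sub>m n 1) (0\<^sub>m 1 n) D1) ?V ?W"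
    by (rule similar_mat_wit_four_block[OF U similar_mat_wit_refl[OF D1] _ _ B1 D1]) (use Uc in auto)
  then have "similar_mat_wit B (mat_diag ?N e) ?V ?W" by (simp only: Bblock[symmetric] De)
  from similar_mat_wit_trans[OF AB this]
  have *: "similar_mat_wit A (mat_diag ?N e) (H * ?V) (?W * H)" .
  have "?V \<in> carrier_mat ?N ?N" using Uc by (auto intro!: carrier_matI)
  then have "transpose_mat (H * ?V) = ?W * H"
    using transpose_mult[OF H(1), of ?V ?N] VT H(2) by simp
  then show ?case using * by metis
qed

text \<open>Two diagonalizations of the same matrix differ by the matrix \<open>M = U\<^sup>T V\<close>, which intertwines
  the two diagonal matrices: \<open>d\<^sub>i M\<^sub>i\<^sub>j = M\<^sub>i\<^sub>j e\<^sub>j\<close>. Wherever \<open>M\<^sub>i\<^sub>j\<close> does not vanish, \<open>d\<^sub>i = e\<^sub>j\<close> and so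
  \<open>f d\<^sub>i = f e\<^sub>j\<close>. Hence \<open>M\<close> intertwines the images under \<open>f\<close> as well.\<close>

lemma mat_fun_eq:
  fixes A :: "real mat"
  assumes A: "A \<in> carrier_mat n n" and w: "similar_mat_wit A (mat_diag n d) U (transpose_mat U)"
  shows "mat_fun f A = U * mat_diag n (\<lambda>i. f (d i)) * transpose_mat U"
  unfolding mat_fun_def
proof (rule the_equality)
  have dimA[simp]: "dim_row A = n" using A by simp
  show "\<exists>V e. similar_mat_wit A (mat_diag (dim_row A) e) V (transpose_mat V) \<and>
      U * mat_diag n (\<lambda>i. f (d i)) * transpose_mat U = V * mat_diag (dim_row A) (\<lambda>i. f (e i)) * transpose_mat V"
    using w by auto
  fix B assume "\<exists>V e. similar_mat_wit A (mat_diag (dim_row A) e) V (transpose_mat V) \<and>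
      B = V * mat_diag (dim_row A) (\<lambda>i. f (e i)) * transpose_mat V"
  then obtain V e where w': "similar_mat_wit A (mat_diag n e) V (transpose_mat V)"
    and B: "B = V * mat_diag n (\<lambda>i. f (e i)) * transpose_mat V" by auto
  let ?D = "mat_diag n d" and ?E = "mat_diag n e"
  let ?fD = "mat_diag n (\<lambda>i. f (d i))" and ?fE = "mat_diag n (\<lambda>i. f (e i))"
  let ?UT = "transpose_mat U" and ?VT = "transpose_mat V"
  note u = similar_mat_witD2[OF A w] and v = similar_mat_witD2[OF A w']
  note [simp] = u(4-7) v(4-7) u(1,2) v(1,2)
  note [simp] = mult_carrier_mat[of _ n n _ n] left_mult_one_mat[of _ n n] right_mult_one_mat[of _ n n]
  note as = assoc_mult_mat[of _ n n _ n _ n]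
  let ?M = "?UT * V"
  have M: "?M \<in> carrier_mat n n" by simp
  have "?D * ?M = ?UT * (U * ?D * ?UT) * V"
    using u(2) by (simp add: as[symmetric])
  also have "\<dots> = ?UT * (V * ?E * ?VT) * V" using u(3) v(3) by simp
  also have "\<dots> = ?UT * V * ?E * (?VT * V)" by (simp add: as)
  also have "\<dots> = ?M * ?E" using v(2) by simp
  finally have comm: "?D * ?M = ?M * ?E" .
  have "?fD * ?M = ?M * ?fE"
  proof (rule eq_matI)
    fix i j assume "i < dim_row (?M * ?fE)" "j < dim_col (?M * ?fE)"
    then have ij: "i < n" "j < n" using M carrier_matD[OF u(6)] by (auto simp: mat_diag_def)
    have "d i * ?M $$ (i,j) = ?M $$ (i,j) * e j"
      using arg_cong[OF comm, of "\<lambda>X. X $$ (i,j)"] ij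
      unfolding mat_diag_mult_left[OF M] mat_diag_mult_right[OF M] by (simp del: index_mult_mat)
    then have "f (d i) * ?M $$ (i,j) = ?M $$ (i,j) * f (e j)" by (cases "?M $$ (i,j) = 0") auto
    then show "(?fD * ?M) $$ (i,j) = (?M * ?fE) $$ (i,j)"
      using ij unfolding mat_diag_mult_left[OF M] mat_diag_mult_right[OF M] by (simp del: index_mult_mat)
  qed (use M carrier_matD[OF u(6)] carrier_matD[OF v(6)] in \<open>auto simp: mat_diag_def\<close>)
  then have "U * (?fD * ?M) * ?VT = U * (?M * ?fE) * ?VT" by simp
  moreover have "U * (?fD * ?M) * ?VT = U * ?fD * ?UT * (V * ?VT)" by (simp add: as)
  moreover have "U * (?M * ?fE) * ?VT = (U * ?UT) * V * ?fE * ?VT" by (simp add: as del: u(1))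
  moreover have "(U * ?UT) * V * ?fE * ?VT = B" using u(1) B by simp
  ultimately show "B = U * ?fD * ?UT" using v(1) by simp
qed

text \<open>The second condition is the completeness of the eigenvectors. Plain functions of indices replace
  matrices here, because the arguments below work with individual entries of the resolvent.\<close>

definition is_eigen_system :: "nat \<Rightarrow> (nat \<Rightarrow> nat \<Rightarrow> real) \<Rightarrow> (nat \<Rightarrow> nat \<Rightarrow> real) \<Rightarrow> (nat \<Rightarrow> real) \<Rightarrow> bool" where
  "is_eigen_system n A u d \<longleftrightarrow>
     (\<forall>p<n. \<forall>q<n. (\<Sum>k<n. u k p * u k q) = (if p = q then 1 else 0)) \<and>
     (\<forall>k<n. \<forall>l<n. (\<Sum>p<n. u k p * u l p) = (if k = l then 1 else 0)) \<and>
     (\<forall>k<n. \<forall>l<n. A k l = (\<Sum>p<n. u k p * d p * u l p))"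

lemma eigen_system_exists:
  assumes A: "A \<in> carrier_mat n n"
    and sym: "\<And>i j. i < n \<Longrightarrow> j < n \<Longrightarrow> A $$ (i,j) = A $$ (j,i)"
  shows "\<exists>u d. is_eigen_system n (\<lambda>i j. A $$ (i,j)) u d \<and>
    (\<forall>f. mat_trace (mat_fun f A) = (\<Sum>p<n. f (d p)))"
proof -
  obtain U d where w: "similar_mat_wit A (mat_diag n d) U (transpose_mat U)"
    using spectral_theorem_real[OF A sym] by blast
  note u = similar_mat_witD2[OF A w]
  let ?u = "\<lambda>i j. U $$ (i,j)"
  have 1: "(\<Sum>k<n. ?u k p * ?u k q) = (if p = q then 1 else 0)" if "p < n" "q < n" for p q
    using arg_cong[OF u(2), of "\<lambda>X. X $$ (p,q)"] that u(6)
    by (simp add: scalar_prod_def lessThan_atLeast0)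
  have 2: "(\<Sum>p<n. ?u k p * ?u l p) = (if k = l then 1 else 0)" if "k < n" "l < n" for k l
    using arg_cong[OF u(1), of "\<lambda>X. X $$ (k,l)"] that u(6)
    by (simp add: scalar_prod_def lessThan_atLeast0)
  have UDU: "(U * mat_diag n g * transpose_mat U) $$ (k,l) = (\<Sum>p<n. ?u k p * g p * ?u l p)"
    if "k < n" "l < n" for k l g
    using that u(6) unfolding mat_diag_mult_right[OF u(6)]
    by (simp add: scalar_prod_def lessThan_atLeast0)
  have "mat_trace (mat_fun f A) = (\<Sum>p<n. f (d p))" for f
  proof -
    have "mat_trace (mat_fun f A) = (\<Sum>k<n. \<Sum>p<n. ?u k p * f (d p) * ?u k p)"
      unfolding mat_fun_eq[OF A w] mat_trace_def using u(6) by (auto intro!: sum.cong simp: UDU simp del: index_mult_mat(1))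
    also have "\<dots> = (\<Sum>p<n. \<Sum>k<n. ?u k p * f (d p) * ?u k p)" by (rule sum.swap)
    also have "\<dots> = (\<Sum>p<n. f (d p) * (\<Sum>k<n. ?u k p * ?u k p))"
      by (simp add: sum_distrib_left mult_ac)
    finally show ?thesis by (simp add: 1)
  qed
  moreover have "A $$ (k,l) = (\<Sum>p<n. ?u k p * d p * ?u l p)" if "k < n" "l < n" for k l
    using UDU[OF that, of d] u(3) by simp
  ultimately show ?thesis
    using 1 2 by (intro exI[of _ ?u] exI[of _ d]) (auto simp: is_eigen_system_def)
qed

section \<open>The resolvent and its derivative in the matrix entries\<close>

text \<open>The entries of the matrix \<open>g(A)\<close>, where \<open>g\<close> is given by its values on the list of eigenvalues.\<close>

definition spectral_sum :: "nat \<Rightarrow> (nat \<Rightarrow> nat \<Rightarrow> real) \<Rightarrow> (nat \<Rightarrow> complex) \<Rightarrow> nat \<Rightarrow> nat \<Rightarrow> complex" where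
  "spectral_sum n u g k l = (\<Sum>p<n. u k p * g p * u l p)"

lemma is_eigen_systemD:
  assumes "is_eigen_system n A u d"
  shows "p < n \<Longrightarrow> q < n \<Longrightarrow> (\<Sum>k<n. u k p * u k q) = (if p = q then 1 else 0)"
    and "k < n \<Longrightarrow> l < n \<Longrightarrow> (\<Sum>p<n. u k p * u l p) = (if k = l then 1 else 0)"
    and "k < n \<Longrightarrow> l < n \<Longrightarrow> A k l = (\<Sum>p<n. u k p * d p * u l p)"
  using assms unfolding is_eigen_system_def by blast+

lemma spectral_sum_commute: "spectral_sum n u g k l = spectral_sum n u g l k"
  by (simp add: spectral_sum_def mult_ac)

lemma cnj_spectral_sum: "cnj (spectral_sum n u g k l) = spectral_sum n u (\<lambda>p. cnj (g p)) k l"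
  by (simp add: spectral_sum_def)

lemma spectral_sum_mult:
  assumes "is_eigen_system n A u d"
  shows "(\<Sum>m<n. spectral_sum n u f k m * spectral_sum n u g m l) = spectral_sum n u (\<lambda>p. f p * g p) k l"
proof -
  note o = is_eigen_systemD(1)[OF assms]
  let ?c = "\<lambda>p q. complex_of_real (u k p) * f p * (g q * complex_of_real (u l q))"
  have "(\<Sum>m<n. spectral_sum n u f k m * spectral_sum n u g m l)
      = (\<Sum>m<n. \<Sum>p<n. \<Sum>q<n. ?c p q * complex_of_real (u m p * u m q))"
    unfolding spectral_sum_def sum_product
    by (rule sum.cong[OF refl], rule sum.cong[OF refl], rule sum.cong[OF refl]) simp
  also have "\<dots> = (\<Sum>p<n. \<Sum>m<n. \<Sum>q<n. ?c p q * complex_of_real (u m p * u m q))"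
    by (rule sum.swap)
  also have "\<dots> = (\<Sum>p<n. \<Sum>q<n. ?c p q * complex_of_real (\<Sum>m<n. u m p * u m q))"
  proof (rule sum.cong[OF refl])
    fix p
    have "(\<Sum>m<n. \<Sum>q<n. ?c p q * complex_of_real (u m p * u m q))
        = (\<Sum>q<n. \<Sum>m<n. ?c p q * complex_of_real (u m p * u m q))" by (rule sum.swap)
    then show "(\<Sum>m<n. \<Sum>q<n. ?c p q * complex_of_real (u m p * u m q))
        = (\<Sum>q<n. ?c p q * complex_of_real (\<Sum>m<n. u m p * u m q))"
      by (simp only: sum_distrib_left of_real_sum)
  qed
  also have "\<dots> = (\<Sum>p<n. \<Sum>q<n. if p = q then ?c p q else 0)"
    by (rule sum.cong[OF refl], rule sum.cong[OF refl]) (simp only: o lessThan_iff, simp)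
  also have "\<dots> = spectral_sum n u (\<lambda>p. f p * g p) k l"
    by (simp add: spectral_sum_def mult.assoc)
  finally show ?thesis .
qed

lemma spectral_sum_trace:
  assumes "is_eigen_system n A u d"
  shows "(\<Sum>k<n. spectral_sum n u f k k) = (\<Sum>p<n. f p)"
proof -
  have o: "(\<Sum>m<n. u m p * u m p) = 1" if "p < n" for p
    using is_eigen_systemD(1)[OF assms that that] by simp
  have "(\<Sum>k<n. spectral_sum n u f k k) = (\<Sum>p<n. \<Sum>k<n. f p * complex_of_real (u k p * u k p))"
    unfolding spectral_sum_def by (subst sum.swap) (simp add: mult_ac)
  also have "\<dots> = (\<Sum>p<n. f p * complex_of_real (\<Sum>k<n. u k p * u k p))"
    by (simp only: sum_distrib_left of_real_sum)
  finally show ?thesis by (simp add: o)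
qed

lemma spectral_sum_pairing:
  assumes "is_eigen_system n A u d"
  shows "(\<Sum>k<n. \<Sum>l<n. spectral_sum n u f k l * spectral_sum n u g k l) = (\<Sum>p<n. f p * g p)"
proof -
  have "(\<Sum>l<n. spectral_sum n u f k l * spectral_sum n u g k l) = spectral_sum n u (\<lambda>p. f p * g p) k k" for k
  proof -
    have "(\<Sum>l<n. spectral_sum n u f k l * spectral_sum n u g k l)
        = (\<Sum>l<n. spectral_sum n u f k l * spectral_sum n u g l k)"
      by (rule sum.cong[OF refl], rule arg_cong[OF spectral_sum_commute])
    then show ?thesis by (simp only: spectral_sum_mult[OF assms])
  qed
  then show ?thesis by (simp add: spectral_sum_trace[OF assms])
qed

lemma spectral_sum_one:
  assumes "is_eigen_system n A u d" "k < n" "l < n"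
  shows "spectral_sum n u (\<lambda>_. 1) k l = (if k = l then 1 else 0)"
proof -
  have "(\<Sum>p<n. u k p * u l p) = (if k = l then 1 else 0)"
    by (rule is_eigen_systemD(2)[OF assms])
  from arg_cong[OF this, of complex_of_real] show ?thesis by (simp add: spectral_sum_def split: if_splits)
qed

lemma spectral_sum_matrix:
  assumes "is_eigen_system n A u d" "k < n" "l < n"
  shows "spectral_sum n u (\<lambda>p. of_real (d p)) k l = of_real (A k l)"
proof -
  have "A k l = (\<Sum>p<n. u k p * d p * u l p)" by (rule is_eigen_systemD(3)[OF assms])
  then show ?thesis by (simp add: spectral_sum_def)
qed

lemma norm_spectral_sum_le:
  assumes "is_eigen_system n A u d" "k < n" "l < n" "\<And>p. p < n \<Longrightarrow> cmod (f p) \<le> c"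
  shows "cmod (spectral_sum n u f k l) \<le> real n * c"
proof -
  have "\<bar>u i p\<bar> \<le> 1" if "i < n" "p < n" for i p
  proof -
    have "(u i p)\<^sup>2 \<le> (\<Sum>k<n. (u k p)\<^sup>2)" by (rule member_le_sum) (use that in auto)
    also have "\<dots> = 1" using is_eigen_systemD(1)[OF assms(1) that(2) that(2)] by (simp add: power2_eq_square)
    finally show ?thesis by (simp add: abs_le_square_iff[of _ 1, simplified])
  qed
  then have "cmod (u k p * f p * u l p) \<le> c" if "p < n" for p
    using assms that mult_mono[OF mult_mono[of "\<bar>u k p\<bar>" 1 "cmod (f p)" c], of "\<bar>u l p\<bar>" 1]
      order_trans[OF norm_ge_zero assms(4)[OF that]]
    by (simp add: norm_mult)
  then show ?thesis unfolding spectral_sum_def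
    using sum_norm_bound[of "{..<n}" "\<lambda>p. u k p * f p * u l p" c] by auto
qed

text \<open>The eigenvectors and eigenvalues are picked arbitrarily for every matrix, so they need not depend
  measurably on it. The resolvent does not depend on the choice and will turn out to be continuous.\<close>

definition eigen_choice :: "nat \<Rightarrow> real mat \<Rightarrow> (nat \<Rightarrow> nat \<Rightarrow> real) \<times> (nat \<Rightarrow> real)" where
  "eigen_choice n A = (SOME x. is_eigen_system n (\<lambda>i j. A $$ (i,j)) (fst x) (snd x) \<and>
    (\<forall>f. mat_trace (mat_fun f A) = (\<Sum>p<n. f (snd x p))))"

abbreviation entry :: "(nat \<times> nat \<Rightarrow> real) \<Rightarrow> nat \<Rightarrow> nat \<Rightarrow> real" where
  "entry a i j \<equiv> a (min i j, max i j)"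

definition evec :: "nat \<Rightarrow> (nat \<times> nat \<Rightarrow> real) \<Rightarrow> nat \<Rightarrow> nat \<Rightarrow> real" where
  "evec n a = fst (eigen_choice n (sym_mat n a))"

definition evalue :: "nat \<Rightarrow> (nat \<times> nat \<Rightarrow> real) \<Rightarrow> nat \<Rightarrow> real" where
  "evalue n a = snd (eigen_choice n (sym_mat n a))"

lemma sym_mat_eigen:
  shows eigen_system_sym_mat: "is_eigen_system n (entry a) (evec n a) (evalue n a)"
    and mat_trace_mat_fun: "mat_trace (mat_fun f (sym_mat n a)) = (\<Sum>p<n. f (evalue n a p))"
proof -
  obtain u d where ud: "is_eigen_system n (\<lambda>i j. sym_mat n a $$ (i,j)) u d \<and>
      (\<forall>f. mat_trace (mat_fun f (sym_mat n a)) = (\<Sum>p<n. f (d p)))"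
    using eigen_system_exists[of "sym_mat n a" n]
    by (auto simp: sym_mat_def min.commute max.commute)
  have "\<exists>x. is_eigen_system n (\<lambda>i j. sym_mat n a $$ (i,j)) (fst x) (snd x) \<and>
      (\<forall>f. mat_trace (mat_fun f (sym_mat n a)) = (\<Sum>p<n. f (snd x p)))"
    by (rule exI[of _ "(u, d)"], unfold fst_conv snd_conv, rule ud)
  from someI_ex[OF this, folded eigen_choice_def, folded evec_def evalue_def]
  have *: "is_eigen_system n (\<lambda>i j. sym_mat n a $$ (i,j)) (evec n a) (evalue n a)"
    "\<And>f. mat_trace (mat_fun f (sym_mat n a)) = (\<Sum>p<n. f (evalue n a p))"
    by blast+
  show "is_eigen_system n (entry a) (evec n a) (evalue n a)"
    using *(1) by (simp add: is_eigen_system_def sym_mat_def)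
  show "mat_trace (mat_fun f (sym_mat n a)) = (\<Sum>p<n. f (evalue n a p))" by fact
qed

definition resolvent :: "nat \<Rightarrow> complex \<Rightarrow> (nat \<times> nat \<Rightarrow> real) \<Rightarrow> nat \<Rightarrow> nat \<Rightarrow> complex" where
  "resolvent n z a = spectral_sum n (evec n a) (\<lambda>p. 1 / (of_real (evalue n a p) - z))"

definition resolvent_trace :: "nat \<Rightarrow> complex \<Rightarrow> (nat \<times> nat \<Rightarrow> real) \<Rightarrow> complex" where
  "resolvent_trace n z a = (\<Sum>k<n. resolvent n z a k k)"

lemma resolvent_commute: "resolvent n z a k l = resolvent n z a l k"
  unfolding resolvent_def by (rule spectral_sum_commute)

text \<open>The second identity is the source of all savings below: a sum of squares \<open>|r|\<^sup>2\<close>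
  over the spectrum costs only \<open>Im X\<close>, which is of order \<open>\<surd>n\<close>, instead of the number \<open>n\<close> of summands.\<close>

lemma inverse_shift_bounds:
  assumes "Im z > 0"
  shows "cmod (1 / (of_real x - z)) \<le> 1 / Im z"
    and "Im (1 / (of_real x - z)) = Im z * (cmod (1 / (of_real x - z)))\<^sup>2"
proof -
  have "Im z \<le> cmod (of_real x - z)" using abs_Im_le_cmod[of "of_real x - z"] assms by simp
  then show "cmod (1 / (of_real x - z)) \<le> 1 / Im z"
    using assms by (simp add: norm_divide divide_simps)
  show "Im (1 / (of_real x - z)) = Im z * (cmod (1 / (of_real x - z)))\<^sup>2"
    by (simp add: norm_divide power_divide Im_divide cmod_power2)
qed

lemma norm_resolvent_le:
  assumes "Im z > 0" "k < n" "l < n"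
  shows "cmod (resolvent n z a k l) \<le> real n / Im z"
  using norm_spectral_sum_le[OF eigen_system_sym_mat assms(2,3) inverse_shift_bounds(1)[OF assms(1)]]
  by (simp add: resolvent_def)

lemma matrix_times_resolvent:
  assumes "Im z > 0" "i < n" "l < n"
  shows "(\<Sum>k<n. entry a i k * resolvent n z a k l) = (if i = l then 1 else 0) + z * resolvent n z a i l"
proof -
  let ?u = "evec n a" and ?d = "evalue n a"
  note es = eigen_system_sym_mat[of n a]
  have nz: "complex_of_real (?d p) \<noteq> z" for p using assms(1) by (auto simp: complex_eq_iff)
  have "(\<Sum>k<n. entry a i k * resolvent n z a k l) =
      (\<Sum>k<n. spectral_sum n ?u (\<lambda>p. of_real (?d p)) i k * spectral_sum n ?u (\<lambda>p. 1 / (of_real (?d p) - z)) k l)"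
    by (intro sum.cong refl) (simp add: spectral_sum_matrix[OF es assms(2)] resolvent_def)
  also have "\<dots> = spectral_sum n ?u (\<lambda>p. of_real (?d p) * (1 / (of_real (?d p) - z))) i l"
    by (rule spectral_sum_mult[OF es])
  also have "\<dots> = spectral_sum n ?u (\<lambda>p. 1 + z * (1 / (of_real (?d p) - z))) i l"
    unfolding spectral_sum_def by (intro sum.cong refl) (use nz in \<open>simp add: divide_simps\<close>)
  also have "\<dots> = spectral_sum n ?u (\<lambda>_. 1) i l + z * resolvent n z a i l"
    by (simp add: spectral_sum_def resolvent_def sum.distrib sum_distrib_left algebra_simps)
  finally show ?thesis by (simp add: spectral_sum_one[OF es assms(2,3)])
qed

lemma resolvent_times_matrix:
  assumes "Im z > 0" "i < n" "l < n"
  shows "(\<Sum>k<n. resolvent n z a i k * entry a k l) = (if i = l then 1 else 0) + z * resolvent n z a i l"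
proof -
  have "(\<Sum>k<n. resolvent n z a i k * entry a k l) = (\<Sum>k<n. entry a l k * resolvent n z a k i)"
  proof (rule sum.cong[OF refl])
    fix k
    show "resolvent n z a i k * entry a k l = entry a l k * resolvent n z a k i"
      unfolding resolvent_commute[of n z a i k] min.commute[of k l] max.commute[of k l] by (rule mult.commute)
  qed
  then show ?thesis
    unfolding matrix_times_resolvent[OF assms(1,3,2)] resolvent_commute[of n z a l i]
    by (cases "i = l") auto
qed

text \<open>Multiply \<open>G\<^sub>b (B - A) G\<^sub>a\<close> out and use \<open>G\<^sub>b (B - z) = 1 = (A - z) G\<^sub>a\<close>.\<close>

lemma resolvent_identity:
  assumes z: "Im z > 0" and kl: "k < n" "l < n"
  shows "resolvent n z b k l - resolvent n z a k l =
    - (\<Sum>p<n. \<Sum>q<n. resolvent n z b k p * (entry b p q - entry a p q) * resolvent n z a q l)"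
proof -
  let ?R = "resolvent n z b" and ?S = "resolvent n z a"
  have "(\<Sum>p<n. \<Sum>q<n. ?R k p * entry b p q * ?S q l) = (\<Sum>q<n. (\<Sum>p<n. ?R k p * entry b p q) * ?S q l)"
    unfolding sum_distrib_right by (rule sum.swap)
  also have "\<dots> = (\<Sum>q<n. (if q = k then ?S q l else 0) + z * ?R k q * ?S q l)"
    by (intro sum.cong refl, subst resolvent_times_matrix[OF z kl(1)]) (auto simp: distrib_right)
  also have "\<dots> = ?S k l + z * (\<Sum>q<n. ?R k q * ?S q l)"
    using kl by (simp add: sum.distrib sum_distrib_left mult.assoc)
  finally have 1: "(\<Sum>p<n. \<Sum>q<n. ?R k p * entry b p q * ?S q l) = ?S k l + z * (\<Sum>q<n. ?R k q * ?S q l)" .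
  have "(\<Sum>p<n. \<Sum>q<n. ?R k p * entry a p q * ?S q l) = (\<Sum>p<n. ?R k p * (\<Sum>q<n. entry a p q * ?S q l))"
    by (simp add: sum_distrib_left mult.assoc)
  also have "\<dots> = (\<Sum>p<n. (if p = l then ?R k p else 0) + z * (?R k p * ?S p l))"
    by (intro sum.cong refl, subst matrix_times_resolvent[OF z _ kl(2)]) (auto simp: distrib_left)
  also have "\<dots> = ?R k l + z * (\<Sum>q<n. ?R k q * ?S q l)"
    using kl by (simp add: sum.distrib sum_distrib_left)
  finally have 2: "(\<Sum>p<n. \<Sum>q<n. ?R k p * entry a p q * ?S q l) = ?R k l + z * (\<Sum>q<n. ?R k q * ?S q l)" .
  show ?thesis using 1 2 by (simp add: sum_subtractf algebra_simps)
qed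

text \<open>An off-diagonal coordinate occurs at two places of the matrix and a diagonal one at a single place,
  where the symmetrized expression counts it twice; this explains the denominator.\<close>

lemma resolvent_identity_coordinate:
  assumes z: "Im z > 0" and kl: "k < n" "l < n" and ij: "i \<le> j" "j < n"
  shows "resolvent n z (a((i,j) := s)) k l - resolvent n z (a((i,j) := t)) k l =
    (s - t) *\<^sub>R ((- (resolvent n z (a((i,j) := s)) k i * resolvent n z (a((i,j) := t)) j l
      + resolvent n z (a((i,j) := s)) k j * resolvent n z (a((i,j) := t)) i l)) / (if i = j then 2 else 1))"
proof -
  let ?R = "resolvent n z (a((i,j) := s))" and ?S = "resolvent n z (a((i,j) := t))"
  let ?c = "complex_of_real (s - t) / (if i = j then 2 else 1)"
  have "?R k l - ?S k l = - (\<Sum>p<n. \<Sum>q<n. ?R k p * (entry (a((i,j) := s)) p q - entry (a((i,j) := t)) p q) * ?S q l)"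
    by (rule resolvent_identity[OF z kl])
  also have "(\<Sum>p<n. \<Sum>q<n. ?R k p * (entry (a((i,j) := s)) p q - entry (a((i,j) := t)) p q) * ?S q l)
    = (\<Sum>p<n. \<Sum>q<n. ?c * ((if p = i then if q = j then ?R k i * ?S j l else 0 else 0)
        + (if p = j then if q = i then ?R k j * ?S i l else 0 else 0)))"
  proof (intro sum.cong refl)
    fix p q
    have "(min p q, max p q) = (i, j) \<longleftrightarrow> p = i \<and> q = j \<or> p = j \<and> q = i"
      using ij(1) by (cases "p \<le> q") auto
    then have "entry (a((i,j) := s)) p q - entry (a((i,j) := t)) p q = (if p = i \<and> q = j \<or> p = j \<and> q = i then s - t else 0)"
      unfolding fun_upd_apply by (simp only:) simp
    then show "?R k p * (entry (a((i,j) := s)) p q - entry (a((i,j) := t)) p q) * ?S q l =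
        ?c * ((if p = i then if q = j then ?R k i * ?S j l else 0 else 0)
        + (if p = j then if q = i then ?R k j * ?S i l else 0 else 0))"
      by (cases "i = j") (auto simp flip: of_real_diff)
  qed
  also have "\<dots> = ?c * (?R k i * ?S j l + ?R k j * ?S i l)"
  proof -
    have "(\<Sum>q<n. if p = i then if q = j then x else 0 else 0) = (if p = i then x else (0::complex))" for p x
      using ij by auto
    moreover have "(\<Sum>q<n. if p = j then if q = i then x else 0 else 0) = (if p = j then x else (0::complex))" for p x
      using ij by auto
    ultimately show ?thesis
      by (simp only: sum_distrib_left[symmetric] sum.distrib) (use ij in simp)
  qed
  moreover have "- (complex_of_real r / d * y) = r *\<^sub>R (- y / d)" for r d y
    by (simp add: scaleR_conv_of_real)
  ultimately show ?thesis by (simp only:)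
qed

text \<open>By the resolvent identity and the bound on the entries, the resolvent is Lipschitz.\<close>

lemma continuous_resolvent:
  assumes z: "Im z > 0" and kl: "k < n" "l < n"
  shows "continuous_on UNIV (\<lambda>a. resolvent n z a k l)"
  unfolding continuous_on_eq_continuous_at[OF open_UNIV] isCont_def
proof (intro ballI)
  fix a :: "nat \<times> nat \<Rightarrow> real"
  let ?g = "\<lambda>b. \<Sum>p<n. \<Sum>q<n. (real n / Im z) * \<bar>entry b p q - entry a p q\<bar> * (real n / Im z)"
  have "continuous_on UNIV ?g"
    by (intro continuous_intros continuous_on_product_coordinates)
  then have "(?g \<longlongrightarrow> ?g a) (at a)"
    unfolding continuous_on_eq_continuous_at[OF open_UNIV] isCont_def by blast
  then have g: "(?g \<longlongrightarrow> 0) (at a)" by simp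
  have "((\<lambda>b. resolvent n z b k l - resolvent n z a k l) \<longlongrightarrow> 0) (at a)"
  proof (rule Lim_null_comparison[OF always_eventually g], rule allI)
    fix b
    show "cmod (resolvent n z b k l - resolvent n z a k l) \<le> ?g b"
      unfolding resolvent_identity[OF z kl] norm_minus_cancel
      by (intro order_trans[OF norm_sum] sum_mono)
         (simp only: norm_mult norm_of_real of_real_diff[symmetric],
          intro mult_mono norm_resolvent_le z kl, use z in auto)
  qed
  then show "((\<lambda>b. resolvent n z b k l) \<longlongrightarrow> resolvent n z a k l) (at a)"
    by (rule LIM_zero_cancel)
qed

text \<open>This is Caratheodory's criterion, for functions of a real variable with values in a
  normed space.\<close>

lemma has_vector_derivativeI_difference_quotient:
  fixes f :: "real \<Rightarrow> 'a::real_normed_vector"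
  assumes eq: "\<And>s. f s - f t = (s - t) *\<^sub>R g s" and g: "isCont g t"
  shows "(f has_vector_derivative g t) (at t)"
proof -
  have "((\<lambda>s. g s - g t) \<longlongrightarrow> 0) (at t)" using g by (simp add: isCont_def LIM_zero)
  then have "((\<lambda>s. norm (f s - f t - (s - t) *\<^sub>R g t) / norm (s - t)) \<longlongrightarrow> 0) (at t)"
    by (rule Lim_transform_eventually[OF tendsto_norm_zero])
       (auto simp: eq eventually_at_filter scaleR_diff_right[symmetric] simp del: scaleR_diff_right)
  then show ?thesis
    by (auto simp: has_vector_derivative_def has_derivative_iff_norm bounded_linear_scaleR_left)
qed

lemma continuous_resolvent_coordinate:
  assumes "Im z > 0" "k < n" "l < n"
  shows "isCont (\<lambda>t. resolvent n z (a(e := t)) k l) x"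
proof -
  have "continuous_on UNIV (\<lambda>t. a(e := t))"
  proof (rule continuous_on_coordinatewise_then_product)
    show "continuous_on UNIV (\<lambda>t. (a(e := t)) i)" for i by (cases "i = e") (auto intro: continuous_intros)
  qed
  from continuous_on_compose2[OF continuous_resolvent[OF assms] this]
  show ?thesis by (simp add: continuous_on_eq_continuous_at)
qed

lemma resolvent_has_vector_derivative:
  assumes z: "Im z > 0" and kl: "k < n" "l < n" and ij: "i \<le> j" "j < n"
  shows "((\<lambda>t. resolvent n z (a((i,j) := t)) k l) has_vector_derivative
    - (resolvent n z (a((i,j) := t)) k i * resolvent n z (a((i,j) := t)) j l
      + resolvent n z (a((i,j) := t)) k j * resolvent n z (a((i,j) := t)) i l) / (if i = j then 2 else 1)) (at t)"
  by (rule has_vector_derivativeI_difference_quotient[OF resolvent_identity_coordinate[OF z kl ij]])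
     (use assms in \<open>auto intro!: continuous_intros continuous_resolvent_coordinate\<close>)

lemma resolvent_trace_eq: "resolvent_trace n z a = (\<Sum>p<n. 1 / (of_real (evalue n a p) - z))"
  unfolding resolvent_trace_def resolvent_def by (rule spectral_sum_trace[OF eigen_system_sym_mat])

text \<open>The two sums are \<open>tr G\<^sup>2\<close> and the trace of \<open>G (G\<^sup>2)\<^sup>*\<close>, that is, the sums of \<open>r\<^sup>2\<close>
  and of \<open>|r|\<^sup>2 cnj r\<close> over the spectrum with \<open>r = 1/(d - z)\<close>.\<close>

lemma resolvent_square_trace_bounds:
  fixes n :: nat and z :: complex and a :: "nat \<times> nat \<Rightarrow> real"
  defines "X \<equiv> resolvent_trace n z a"
  assumes z: "Im z > 0"
  shows "0 \<le> Im X"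
    and "cmod (\<Sum>k<n. \<Sum>l<n. resolvent n z a k l * resolvent n z a k l) \<le> cmod X / Im z"
    and "cmod (\<Sum>k<n. \<Sum>l<n. resolvent n z a k l * cnj (\<Sum>m<n. resolvent n z a k m * resolvent n z a m l))
      \<le> cmod X / (Im z)\<^sup>2"
proof -
  let ?u = "evec n a" and ?d = "evalue n a"
  define r where "r p = 1 / (of_real (?d p) - z)" for p
  note es = eigen_system_sym_mat[of n a]
  have R: "resolvent n z a = spectral_sum n ?u r" by (simp add: resolvent_def r_def[abs_def])
  have X: "X = (\<Sum>p<n. r p)" unfolding X_def r_def by (rule resolvent_trace_eq)
  have ImX: "Im X = Im z * (\<Sum>p<n. (cmod (r p))\<^sup>2)"
    unfolding X Im_sum sum_distrib_left r_def inverse_shift_bounds(2)[OF z] ..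
  show "0 \<le> Im X" unfolding ImX using z by (simp add: sum_nonneg)
  have sq: "(\<Sum>p<n. (cmod (r p))\<^sup>2) \<le> cmod X / Im z"
    using ImX abs_Im_le_cmod[of X] z by (simp add: field_simps)
  have "(\<Sum>k<n. \<Sum>l<n. resolvent n z a k l * resolvent n z a k l) = (\<Sum>p<n. r p * r p)"
    unfolding R by (rule spectral_sum_pairing[OF es])
  then have "cmod (\<Sum>k<n. \<Sum>l<n. resolvent n z a k l * resolvent n z a k l) \<le> (\<Sum>p<n. (cmod (r p))\<^sup>2)"
    by (auto intro!: order_trans[OF norm_sum] simp: norm_mult power2_eq_square)
  then show "cmod (\<Sum>k<n. \<Sum>l<n. resolvent n z a k l * resolvent n z a k l) \<le> cmod X / Im z"
    using sq by linarith
  have "(\<Sum>k<n. \<Sum>l<n. resolvent n z a k l * cnj (\<Sum>m<n. resolvent n z a k m * resolvent n z a m l))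
     = (\<Sum>p<n. r p * cnj (r p * r p))"
    unfolding R spectral_sum_mult[OF es] cnj_spectral_sum by (rule spectral_sum_pairing[OF es])
  also have "cmod \<dots> \<le> (\<Sum>p<n. 1 / Im z * (cmod (r p))\<^sup>2)"
  proof (intro order_trans[OF norm_sum] sum_mono)
    fix p
    have "cmod (r p * cnj (r p * r p)) = cmod (r p) * (cmod (r p))\<^sup>2"
      by (simp add: norm_mult power2_eq_square)
    also have "\<dots> \<le> 1 / Im z * (cmod (r p))\<^sup>2"
      unfolding r_def by (intro mult_right_mono inverse_shift_bounds(1) z) simp
    finally show "cmod (r p * cnj (r p * r p)) \<le> 1 / Im z * (cmod (r p))\<^sup>2" .
  qed
  also have "\<dots> \<le> 1 / Im z * (cmod X / Im z)"
    unfolding sum_distrib_left[symmetric] by (rule mult_left_mono[OF sq]) (use z in auto)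
  finally show "cmod (\<Sum>k<n. \<Sum>l<n. resolvent n z a k l * cnj (\<Sum>m<n. resolvent n z a k m * resolvent n z a m l))
      \<le> cmod X / (Im z)\<^sup>2" by (simp add: power2_eq_square)
qed

section \<open>Gaussian integration by parts\<close>

lemma prob_space_gaussian: "v \<ge> 0 \<Longrightarrow> prob_space (gaussian v)"
  unfolding gaussian_def by (auto intro: prob_space_return prob_space_normal_density)

lemma sets_gaussian [simp, measurable_cong]: "sets (gaussian v) = sets borel"
  by (simp add: gaussian_def)

lemma space_gaussian [simp]: "space (gaussian v) = UNIV"
  by (simp add: gaussian_def)

lemma gaussian_integral_pos:
  fixes f :: "real \<Rightarrow> 'b::{banach, second_countable_topology}"
  assumes "v > 0" "f \<in> borel_measurable borel"
  shows "(\<integral>x. f x \<partial>gaussian v) = (\<integral>x. normal_density 0 (sqrt v) x *\<^sub>R f x \<partial>lborel)"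
  using assms by (simp add: gaussian_def integral_density)

lemma integrable_gaussian_id: "v > 0 \<Longrightarrow> integrable (gaussian v) (\<lambda>x. x)"
  using integrable_normal_moment_nz_1[of "sqrt v" 0]
  by (simp add: gaussian_def integrable_density)

text \<open>With the density included, the integrands differ by a multiple of the derivative of the product of \<open>h\<close> with the normal density,
  which vanishes at infinity.\<close>

lemma gaussian_integration_by_parts:
  fixes h h' :: "real \<Rightarrow> complex"
  assumes v: "v > 0"
    and D: "\<And>t. (h has_vector_derivative h' t) (at t)"
    and cont: "\<And>t. isCont h' t"
    and bd: "\<And>t. norm (h t) \<le> C" "\<And>t. norm (h' t) \<le> C"
  shows "(\<integral>x. x *\<^sub>R h x \<partial>gaussian v) = v *\<^sub>R (\<integral>x. h' x \<partial>gaussian v)"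
proof -
  define g where "g = normal_density 0 (sqrt v)"
  have g_eq: "g x = 1 / sqrt (2 * pi * v) * exp (- x\<^sup>2 / (2 * v))" for x
    using v by (simp add: g_def normal_density_def)
  have g_deriv: "(g has_vector_derivative (- (x / v) * g x)) (at x)" for x
    unfolding g_eq[abs_def] has_real_derivative_iff_has_vector_derivative[symmetric]
    using v by (auto intro!: derivative_eq_intros simp: field_simps)
  have g_cont: "isCont g x" for x unfolding g_eq[abs_def] using v by (auto intro!: continuous_intros)
  have h_cont: "isCont h x" for x
    using D has_vector_derivative_continuous continuous_within by blast
  have [measurable]: "h \<in> borel_measurable borel" "h' \<in> borel_measurable borel" "g \<in> borel_measurable borel"
    by (auto intro!: borel_measurable_continuous_onI continuous_at_imp_continuous_on h_cont cont g_cont)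
  have g_nonneg: "g x \<ge> 0" for x by (simp add: g_def)
  let ?F = "\<lambda>x. g x *\<^sub>R h x"
  let ?f = "\<lambda>x. g x *\<^sub>R h' x + (- (x / v) * g x) *\<^sub>R h x"
  have int1: "integrable lborel (\<lambda>x. g x *\<^sub>R h' x)"
  proof (rule Bochner_Integration.integrable_bound[where f = "\<lambda>x. C * g x"])
    show "integrable lborel (\<lambda>x. C * g x)" using v by (simp add: g_def)
    show "AE x in lborel. norm (g x *\<^sub>R h' x) \<le> norm (C * g x)"
      using mult_left_mono[OF bd(2) g_nonneg] g_nonneg order_trans[OF norm_ge_zero bd(2)]
      by (auto intro!: AE_I2 simp: mult.commute[of C])
  qed measurable
  have int2: "integrable lborel (\<lambda>x. (x * g x) *\<^sub>R h x)"
  proof (rule Bochner_Integration.integrable_bound[where f = "\<lambda>x. C * (g x * x)"])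
    show "integrable lborel (\<lambda>x. C * (g x * x))"
      using integrable_normal_moment_nz_1[of "sqrt v" 0] v by (simp add: g_def)
    show "AE x in lborel. norm ((x * g x) *\<^sub>R h x) \<le> norm (C * (g x * x))"
    proof (rule AE_I2)
      fix x
      have "\<bar>x * g x\<bar> * cmod (h x) \<le> \<bar>x * g x\<bar> * C" by (rule mult_left_mono[OF bd(1)]) simp
      then show "norm ((x * g x) *\<^sub>R h x) \<le> norm (C * (g x * x))"
        using order_trans[OF norm_ge_zero bd(1)] by (simp add: abs_mult mult_ac)
    qed
  qed measurable
  have int: "integrable lborel ?f"
    using Bochner_Integration.integrable_add[OF int1 integrable_scaleR_right[OF int2, of "- (1 / v)"]] by simp
  have F_le: "norm (?F x) \<le> C * g x" for x
    using mult_left_mono[OF bd(1)[of x] g_nonneg[of x]] g_nonneg[of x] by (simp add: mult.commute)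
  have lim_top: "(?F \<longlongrightarrow> 0) at_top"
  proof (rule Lim_null_comparison[OF always_eventually])
    show "((\<lambda>x. C * g x) \<longlongrightarrow> 0) at_top" unfolding g_eq using v by real_asymp
  qed (use F_le in blast)
  have lim_bot: "(?F \<longlongrightarrow> 0) at_bot"
  proof (rule Lim_null_comparison[OF always_eventually])
    show "((\<lambda>x. C * g x) \<longlongrightarrow> 0) at_bot" unfolding g_eq using v by real_asymp
  qed (use F_le in blast)
  have "(LBINT x=-\<infinity>..\<infinity>. ?f x) = 0 - 0"
  proof (rule interval_integral_FTC_integrable[where F = ?F])
    show "(?F has_vector_derivative ?f x) (at x)" for x
      by (rule has_vector_derivative_scaleR[OF g_deriv[folded has_real_derivative_iff_has_vector_derivative] D])
    show "isCont ?f x" for x using v by (auto intro!: continuous_intros g_cont h_cont cont)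
    show "set_integrable lborel (einterval (-\<infinity>) \<infinity>) ?f" using int by (simp add: set_integrable_def)
    show "((?F \<circ> real_of_ereal) \<longlongrightarrow> 0) (at_right (-\<infinity>))" using lim_bot by (simp add: ereal_tendsto_simps)
    show "((?F \<circ> real_of_ereal) \<longlongrightarrow> 0) (at_left \<infinity>)" using lim_top by (simp add: ereal_tendsto_simps)
  qed simp
  then have "(\<integral>x. ?f x \<partial>lborel) = 0"
    by (simp add: interval_lebesgue_integral_def set_lebesgue_integral_def)
  also have "(\<integral>x. ?f x \<partial>lborel) = (\<integral>x. g x *\<^sub>R h' x \<partial>lborel) - (1 / v) *\<^sub>R (\<integral>x. (x * g x) *\<^sub>R h x \<partial>lborel)"
  proof -
    have "?f x = g x *\<^sub>R h' x + (- (1 / v)) *\<^sub>R ((x * g x) *\<^sub>R h x)" for x by simp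
    then have "(\<integral>x. ?f x \<partial>lborel) = (\<integral>x. g x *\<^sub>R h' x \<partial>lborel) + (- (1 / v)) *\<^sub>R (\<integral>x. (x * g x) *\<^sub>R h x \<partial>lborel)"
      by (simp only: Bochner_Integration.integral_add[OF int1 integrable_scaleR_right[OF int2]] integral_scaleR_right)
    then show ?thesis by simp
  qed
  finally have "v *\<^sub>R (\<integral>x. g x *\<^sub>R h' x \<partial>lborel) = (\<integral>x. (x * g x) *\<^sub>R h x \<partial>lborel)"
    using v by (simp add: field_simps scaleR_conv_of_real)
  then show ?thesis
    using v by (simp add: gaussian_integral_pos g_def[symmetric] mult.commute)
qed

abbreviation upper_pairs :: "nat \<Rightarrow> (nat \<times> nat) set" where
  "upper_pairs n \<equiv> {(i, j). i \<le> j \<and> j < n}"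

lemma finite_upper_pairs: "finite (upper_pairs n)"
  by (rule finite_subset[of _ "{..<n} \<times> {..<n}"]) auto

definition goe_var :: "nat \<times> nat \<Rightarrow> real" where
  "goe_var e = (if fst e = snd e then 2 else 1)"

lemma goe_eq: "goe n 1 = PiM (upper_pairs n) (\<lambda>e. gaussian (goe_var e))"
  unfolding goe_def goe_var_def by (rule arg_cong[of _ _ "PiM (upper_pairs n)"]) (auto simp: fun_eq_iff)

lemma goe_var_pos: "goe_var e > 0" by (simp add: goe_var_def)

interpretation gauss: product_prob_space "\<lambda>e. gaussian (goe_var e)" I for I
  by (intro product_prob_spaceI prob_space_gaussian less_imp_le goe_var_pos)

lemma prob_space_goe: "prob_space (goe n 1)"
  unfolding goe_eq by (intro prob_space_PiM prob_space_gaussian less_imp_le goe_var_pos)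

text \<open>Functions of the matrix that are well behaved enough to be integrated by parts in every
  coordinate. Points of the product space are undefined outside the index set, so the last
  condition is needed to compare such a function on the product space with a
  continuous function on the space of all families.\<close>

definition goe_observable :: "nat \<Rightarrow> ((nat \<times> nat \<Rightarrow> real) \<Rightarrow> complex) \<Rightarrow> bool" where
  "goe_observable n f \<longleftrightarrow> continuous_on UNIV f \<and> bounded (range f) \<and>
     (\<forall>a b. (\<forall>e\<in>upper_pairs n. a e = b e) \<longrightarrow> f a = f b)"

lemma goe_observable_const: "goe_observable n (\<lambda>_. c)"
  by (auto simp: goe_observable_def)

lemma goe_observable_cnj: "goe_observable n f \<Longrightarrow> goe_observable n (\<lambda>a. cnj (f a))"
  by (auto simp: goe_observable_def bounded_iff intro!: continuous_intros)

lemma goe_observable_uminus: "goe_observable n f \<Longrightarrow> goe_observable n (\<lambda>a. - f a)"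
  by (auto simp: goe_observable_def bounded_iff intro!: continuous_intros)

lemma goe_observable_add:
  assumes "goe_observable n f" "goe_observable n g" shows "goe_observable n (\<lambda>a. f a + g a)"
proof -
  obtain B C where "\<And>a. norm (f a) \<le> B" "\<And>a. norm (g a) \<le> C"
    using assms by (auto simp: goe_observable_def bounded_iff)
  then have "norm (f a + g a) \<le> B + C" for a by (intro norm_triangle_mono)
  then show ?thesis using assms unfolding goe_observable_def bounded_iff
    by (auto intro!: continuous_intros arg_cong2[of _ _ _ _ "(+)"])
qed

lemma goe_observable_mult:
  assumes "goe_observable n f" "goe_observable n g" shows "goe_observable n (\<lambda>a. f a * g a)"
proof -
  obtain B C where BC: "\<And>a. norm (f a) \<le> B" "\<And>a. norm (g a) \<le> C"
    using assms by (auto simp: goe_observable_def bounded_iff)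
  then have "norm (f a * g a) \<le> B * C" for a
    unfolding norm_mult by (intro mult_mono order_trans[OF norm_ge_zero BC(1)]) auto
  then show ?thesis using assms unfolding goe_observable_def bounded_iff
    by (auto intro!: continuous_intros arg_cong2[of _ _ _ _ "(*)"])
qed

lemma goe_observable_sum:
  "(\<And>i. i \<in> I \<Longrightarrow> goe_observable n (f i)) \<Longrightarrow> goe_observable n (\<lambda>a. \<Sum>i\<in>I. f i a)"
  by (induction I rule: infinite_finite_induct) (auto intro: goe_observable_const goe_observable_add)

lemma goe_observable_resolvent:
  assumes "Im z > 0" "k < n" "l < n"
  shows "goe_observable n (\<lambda>a. resolvent n z a k l)"
proof -
  have "resolvent n z a k l = resolvent n z b k l" if "\<forall>e\<in>upper_pairs n. a e = b e" for a b
  proof -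
    have "entry a i j = entry b i j" if "i < n" "j < n" for i j
      by (rule bspec[OF \<open>\<forall>e\<in>upper_pairs n. a e = b e\<close>]) (use that in auto)
    then have "sym_mat n a = sym_mat n b" by (intro eq_matI) (auto simp: sym_mat_def)
    then show ?thesis by (simp add: resolvent_def evec_def evalue_def)
  qed
  then show ?thesis
    using continuous_resolvent[OF assms] norm_resolvent_le[OF assms]
    by (auto simp: goe_observable_def bounded_iff)
qed

text \<open>Extending a family by zero is measurable, and continuous functions on a countable
  product of copies of the real line are measurable for the product sigma-algebra.\<close>

lemma goe_observable_integrable:
  assumes f: "goe_observable n f"
  shows "integrable (goe n 1) f"
proof -
  interpret prob_space "goe n 1" by (rule prob_space_goe)
  let ?ext = "\<lambda>(a :: nat \<times> nat \<Rightarrow> real) e. if e \<in> upper_pairs n then a e else 0"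
  have "?ext \<in> measurable (goe n 1) (PiM UNIV (\<lambda>_. borel))"
    unfolding goe_eq
  proof (rule measurable_PiM_single')
    fix e :: "nat \<times> nat"
    show "(\<lambda>a. ?ext a e) \<in> borel_measurable (PiM (upper_pairs n) (\<lambda>e. gaussian (goe_var e)))"
    proof (cases "e \<in> upper_pairs n")
      case True
      have "(\<lambda>a. a e) \<in> measurable (PiM (upper_pairs n) (\<lambda>e. gaussian (goe_var e))) (gaussian (goe_var e))"
        by (rule measurable_component_singleton[OF True])
      then show ?thesis using True by (simp add: measurable_cong_sets[OF refl sets_gaussian])
    qed (simp only: if_False measurable_const space_borel UNIV_I)
  qed auto
  then have "?ext \<in> measurable (goe n 1) borel"
    using measurable_cong_sets[OF refl sets_PiM_equal_borel] by blast
  moreover have "f \<in> borel_measurable borel"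
    using f by (auto simp: goe_observable_def intro: borel_measurable_continuous_onI)
  ultimately have "(\<lambda>a. f (?ext a)) \<in> borel_measurable (goe n 1)"
    by (rule measurable_compose)
  moreover have "f (?ext a) = f a" for a using f by (auto simp: goe_observable_def)
  ultimately have "f \<in> borel_measurable (goe n 1)" by simp
  moreover obtain B where "\<And>a. norm (f a) \<le> B" using f by (auto simp: goe_observable_def bounded_iff)
  ultimately show ?thesis by (intro integrable_const_bound[of _ B]) auto
qed

text \<open>Fubini reduces this to the one-dimensional case in the coordinate \<open>e\<close>.\<close>

lemma goe_integration_by_parts:
  assumes e: "e \<in> upper_pairs n" and F: "goe_observable n F" and F': "goe_observable n F'"
    and D: "\<And>a t. ((\<lambda>t. F (a(e := t))) has_vector_derivative F' (a(e := t))) (at t)"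
  shows "integrable (goe n 1) (\<lambda>a. a e *\<^sub>R F a)"
    and "(\<integral>a. a e *\<^sub>R F a \<partial>goe n 1) = goe_var e *\<^sub>R (\<integral>a. F' a \<partial>goe n 1)"
proof -
  let ?M = "\<lambda>e. gaussian (goe_var e)"
  define J where "J = upper_pairs n - {e}"
  have J: "finite J" "e \<notin> J" "upper_pairs n = insert e J" using e finite_upper_pairs by (auto simp: J_def)
  obtain B where B: "\<And>a. norm (F a) \<le> B" using F by (auto simp: goe_observable_def bounded_iff)
  obtain B' where B': "\<And>a. norm (F' a) \<le> B'" using F' by (auto simp: goe_observable_def bounded_iff)
  have "distr (PiM (upper_pairs n) ?M) (?M e) (\<lambda>a. a e) = ?M e"
    by (rule gauss.PiM_component[OF e])
  then have "integrable (distr (goe n 1) (?M e) (\<lambda>a. a e)) (\<lambda>x. x)"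
    using integrable_gaussian_id[OF goe_var_pos[of e]] by (simp add: goe_eq)
  then have "integrable (goe n 1) (\<lambda>a. a e)"
    by (subst (asm) integrable_distr_eq) (auto simp: goe_eq intro!: measurable_component_singleton e)
  then have ie: "integrable (goe n 1) (\<lambda>a. B * a e)" by simp
  show int: "integrable (goe n 1) (\<lambda>a. a e *\<^sub>R F a)"
  proof (rule Bochner_Integration.integrable_bound[OF ie])
    show "(\<lambda>a. a e *\<^sub>R F a) \<in> borel_measurable (goe n 1)"
      using borel_measurable_integrable[OF \<open>integrable (goe n 1) (\<lambda>a. a e)\<close>]
        borel_measurable_integrable[OF goe_observable_integrable[OF F]] by measurable
    have "norm (a e *\<^sub>R F a) \<le> norm (B * a e)" for a
      using mult_left_mono[OF B[of a], of "\<bar>a e\<bar>"] order_trans[OF norm_ge_zero B]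
      by (simp add: abs_mult mult.commute)
    then show "AE a in goe n 1. norm (a e *\<^sub>R F a) \<le> norm (B * a e)" by simp
  qed
  have inner: "(\<integral>y. (a(e := y)) e *\<^sub>R F (a(e := y)) \<partial>?M e) = goe_var e *\<^sub>R (\<integral>y. F' (a(e := y)) \<partial>?M e)" for a
  proof -
    have ext: "continuous_on UNIV (\<lambda>t. a(e := t))"
    proof (rule continuous_on_coordinatewise_then_product)
      show "continuous_on UNIV (\<lambda>t. (a(e := t)) i)" for i by (cases "i = e") (auto intro: continuous_intros)
    qed
    have "continuous_on UNIV F'" using F' by (simp add: goe_observable_def)
    from continuous_on_compose2[OF this ext] have "(\<integral>y. y *\<^sub>R F (a(e := y)) \<partial>?M e) = goe_var e *\<^sub>R (\<integral>y. F' (a(e := y)) \<partial>?M e)"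
      using gaussian_integration_by_parts[OF goe_var_pos D, of a "max B B'" e] B B'
      by (simp add: continuous_on_eq_continuous_at le_max_iff_disj)
    then show ?thesis by simp
  qed
  have "(\<integral>a. a e *\<^sub>R F a \<partial>goe n 1) = (\<integral>a. (\<integral>y. (a(e := y)) e *\<^sub>R F (a(e := y)) \<partial>?M e) \<partial>PiM J ?M)"
    using int unfolding goe_eq J(3) by (rule gauss.product_integral_insert[OF J(1,2)])
  also have "\<dots> = goe_var e *\<^sub>R (\<integral>a. (\<integral>y. F' (a(e := y)) \<partial>?M e) \<partial>PiM J ?M)"
    unfolding inner by simp
  also have "(\<integral>a. (\<integral>y. F' (a(e := y)) \<partial>?M e) \<partial>PiM J ?M) = (\<integral>a. F' a \<partial>goe n 1)"
    using goe_observable_integrable[OF F'] unfolding goe_eq J(3)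
    by (rule gauss.product_integral_insert[OF J(1,2), symmetric])
  finally show "(\<integral>a. a e *\<^sub>R F a \<partial>goe n 1) = goe_var e *\<^sub>R (\<integral>a. F' a \<partial>goe n 1)" .
qed

section \<open>The loop equation and the concentration of the resolvent trace\<close>

text \<open>The multiplicity of a coordinate in the matrix is inversely proportional to its variance.
  This is the orthogonal invariance of the ensemble, and it makes the traces in the loop
  equation close up.\<close>

lemma sum_symmetric_eq_sum_upper_pairs:
  fixes S :: "nat \<Rightarrow> nat \<Rightarrow> complex"
  assumes "\<And>i j. S i j = S j i"
  shows "(\<Sum>i<n. \<Sum>j<n. S i j) = (\<Sum>(i,j)\<in>upper_pairs n. 2 / goe_var (i,j) * S i j)"
proof -
  let ?L = "{(i,j). j < i \<and> i < n}" and ?U = "{(i,j). i < j \<and> j < n}" and ?D = "(\<lambda>i. (i,i)) ` {..<n}"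
  have fin: "finite ?L" "finite ?U" "finite ?D"
    by (rule finite_subset[of _ "{..<n} \<times> {..<n}"]; auto)+
  have L: "(\<Sum>(i,j)\<in>?L. S i j) = (\<Sum>(i,j)\<in>?U. S i j)"
    by (rule sum.reindex_bij_witness[of _ prod.swap prod.swap]) (auto simp: assms)
  have "(\<Sum>i<n. \<Sum>j<n. S i j) = (\<Sum>(i,j)\<in>{..<n} \<times> {..<n}. S i j)" by (rule sum.cartesian_product)
  also have "{..<n} \<times> {..<n} = ?L \<union> (?U \<union> ?D)" by auto
  also have "(\<Sum>(i,j)\<in>?L \<union> (?U \<union> ?D). S i j) = (\<Sum>(i,j)\<in>?L. S i j) + ((\<Sum>(i,j)\<in>?U. S i j) + (\<Sum>(i,j)\<in>?D. S i j))"
    by (subst sum.union_disjoint; (use fin in auto)?)+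
  also have "\<dots> = (\<Sum>(i,j)\<in>?U. 2 / goe_var (i,j) * S i j) + (\<Sum>(i,j)\<in>?D. 2 / goe_var (i,j) * S i j)"
  proof -
    have "(\<Sum>(i,j)\<in>?U. 2 / goe_var (i,j) * S i j) = (\<Sum>(i,j)\<in>?U. 2 * S i j)"
      by (intro sum.cong refl) (auto simp: goe_var_def)
    also have "\<dots> = 2 * (\<Sum>(i,j)\<in>?U. S i j)" by (simp add: sum_distrib_left case_prod_unfold)
    finally have U: "(\<Sum>(i,j)\<in>?U. 2 / goe_var (i,j) * S i j) = 2 * (\<Sum>(i,j)\<in>?U. S i j)" .
    have D: "(\<Sum>(i,j)\<in>?D. 2 / goe_var (i,j) * S i j) = (\<Sum>(i,j)\<in>?D. S i j)"
      by (intro sum.cong refl) (auto simp: goe_var_def)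
    show ?thesis unfolding L U D by simp
  qed
  also have "\<dots> = (\<Sum>(i,j)\<in>?U \<union> ?D. 2 / goe_var (i,j) * S i j)"
    by (subst sum.union_disjoint; (use fin in auto)?)
  also have "?U \<union> ?D = upper_pairs n" by auto
  finally show ?thesis .
qed

context
  fixes n :: nat and z :: complex
  assumes z: "Im z > 0"
begin

private abbreviation (input) "G \<equiv> resolvent n z"
private abbreviation (input) "X \<equiv> resolvent_trace n z"
private abbreviation (input) "W \<equiv> \<lambda>a. (X a)\<^sup>2 + of_nat n"
private abbreviation (input) "G2 \<equiv> \<lambda>a i j. \<Sum>m<n. G a i m * G a m j"

lemma goe_observable_trace: "goe_observable n X"
  unfolding resolvent_trace_def[abs_def] by (intro goe_observable_sum goe_observable_resolvent z) auto

lemma goe_observable_W: "goe_observable n W"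
  unfolding power2_eq_square by (intro goe_observable_add goe_observable_mult goe_observable_trace goe_observable_const)

lemma goe_observable_G2: "i < n \<Longrightarrow> j < n \<Longrightarrow> goe_observable n (\<lambda>a. G2 a i j)"
  by (intro goe_observable_sum goe_observable_mult goe_observable_resolvent z) auto

lemma trace_has_vector_derivative:
  assumes ij: "i \<le> j" "j < n"
  shows "((\<lambda>t. X (a((i,j) := t))) has_vector_derivative
    - 2 / goe_var (i,j) * G2 (a((i,j) := t)) i j) (at t)"
proof -
  let ?b = "a((i,j) := t)"
  have "((\<lambda>t. X (a((i,j) := t))) has_vector_derivative
      (\<Sum>k<n. - (G ?b k i * G ?b j k + G ?b k j * G ?b i k) / (if i = j then 2 else 1))) (at t)"
    unfolding resolvent_trace_def
    by (intro has_vector_derivative_sum resolvent_has_vector_derivative z ij) auto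
  also have "(\<Sum>k<n. - (G ?b k i * G ?b j k + G ?b k j * G ?b i k) / (if i = j then 2 else 1))
      = (\<Sum>k<n. - 2 / goe_var (i,j) * (G ?b i k * G ?b k j))"
  proof (rule sum.cong[OF refl])
    fix k
    show "- (G ?b k i * G ?b j k + G ?b k j * G ?b i k) / (if i = j then 2 else 1)
        = - 2 / goe_var (i,j) * (G ?b i k * G ?b k j)"
      unfolding resolvent_commute[of n z ?b k i] resolvent_commute[of n z ?b j k]
      by (simp add: goe_var_def mult.commute)
  qed
  finally show ?thesis by (simp only: sum_distrib_left)
qed

text \<open>Evaluate the expectation of \<open>tr (A G) cnj W\<close> in two ways. On one side, \<open>A G = 1 + z G\<close>, so that
  \<open>tr (A G) = n + z X\<close>. On the other side, integrate by parts in every entry of \<open>A\<close>. The derivatives of the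
  entries of \<open>G\<close> add up to \<open>-(X\<^sup>2 + tr G\<^sup>2)\<close> and those of \<open>cnj W\<close> produce the last term. Solve
  for the contribution of \<open>W cnj W\<close>.\<close>

lemma loop_equation:
  "(\<integral>a. W a * cnj (W a) \<partial>goe n 1) =
   (\<integral>a. - (z * X a + (\<Sum>k<n. \<Sum>l<n. G a k l * G a k l)) * cnj (W a)
        - 4 * cnj (X a) * (\<Sum>k<n. \<Sum>l<n. G a k l * cnj (G2 a k l)) \<partial>goe n 1)"
proof -
  (* F' i j is the derivative of F i j in the coordinate (i, j). Up to the weights 2 / goe_var (i, j), the
     terms 2 * F' i j are the entries of the symmetric matrix S. *)
  define F where "F i j a = G a i j * cnj (W a)" for i j a
  define F' where "F' i j a = - (G a i i * G a j j + G a i j * G a i j) / goe_var (i,j) * cnj (W a)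
      + G a i j * cnj (2 * X a * (- 2 / goe_var (i,j) * G2 a i j))" for i j a
  define S where "S a i j = - (G a i i * G a j j + G a i j * G a i j) * cnj (W a)
      + G a i j * cnj (- 4 * X a * G2 a i j)" for i j a
  have smF: "goe_observable n (F i j)" if "(i,j) \<in> upper_pairs n" for i j
    unfolding F_def
    by (intro goe_observable_mult goe_observable_cnj goe_observable_W goe_observable_resolvent z) (use that in auto)
  have smF': "goe_observable n (F' i j)" if "(i,j) \<in> upper_pairs n" for i j
    unfolding F'_def divide_inverse
    by (intro goe_observable_add goe_observable_mult goe_observable_uminus goe_observable_cnj goe_observable_W goe_observable_const
      goe_observable_G2 goe_observable_trace goe_observable_resolvent z) (use that in auto)
  have D: "((\<lambda>t. F i j (a((i,j) := t))) has_vector_derivative F' i j (a((i,j) := t))) (at t)"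
    if "(i,j) \<in> upper_pairs n" for i j a t
  proof -
    let ?b = "a((i,j) := t)"
    have ij: "i \<le> j" "j < n" "i < n" using that by auto
    have W': "((\<lambda>t. W (a((i,j) := t))) has_vector_derivative
        (2 * X ?b * (- 2 / goe_var (i,j) * G2 ?b i j))) (at t)"
    proof -
      have "((\<lambda>t. X (a((i,j) := t)) * X (a((i,j) := t)) + of_nat n) has_vector_derivative
        (X ?b * (- 2 / goe_var (i,j) * G2 ?b i j) + (- 2 / goe_var (i,j) * G2 ?b i j) * X ?b) + 0) (at t)"
        by (intro has_vector_derivative_add has_vector_derivative_mult trace_has_vector_derivative ij
          has_vector_derivative_const)
      then show ?thesis by (simp only: power2_eq_square) (simp add: algebra_simps)
    qed
    have G': "((\<lambda>t. G (a((i,j) := t)) i j) has_vector_derivative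
        - (G ?b i i * G ?b j j + G ?b i j * G ?b i j) / goe_var (i,j)) (at t)"
      using resolvent_has_vector_derivative[OF z ij(3,2,1,2), of a t]
      by (simp only: goe_var_def fst_conv snd_conv if_distrib[of complex_of_real] of_real_numeral of_real_1)
    have "((\<lambda>t. G (a((i,j) := t)) i j * cnj (W (a((i,j) := t)))) has_vector_derivative
        (G ?b i j * cnj (2 * X ?b * (- 2 / goe_var (i,j) * G2 ?b i j))
        + - (G ?b i i * G ?b j j + G ?b i j * G ?b i j) / goe_var (i,j) * cnj (W ?b))) (at t)"
      by (rule has_vector_derivative_mult[OF G' has_vector_derivative_cnj[OF W']])
    then show ?thesis unfolding F_def F'_def by (simp only: add.commute)
  qed
  have symS: "S a i j = S a j i" for a i j
  proof -
    have "G2 a i j = G2 a j i"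
      by (rule sum.cong[OF refl]) (metis mult.commute resolvent_commute)
    then show ?thesis
      unfolding S_def resolvent_commute[of n z a i j] by (simp only: mult.commute[of "G a i i"])
  qed
  have lhs: "(of_nat n + z * X a) * cnj (W a) = (\<Sum>(i,j)\<in>upper_pairs n. 2 / goe_var (i,j) * (a (i,j) *\<^sub>R F i j a))" for a
  proof -
    have "(\<Sum>i<n. \<Sum>k<n. entry a i k * G a k i) = (\<Sum>i<n. 1 + z * G a i i)"
      by (intro sum.cong refl, subst matrix_times_resolvent[OF z]) auto
    also have "\<dots> = of_nat n + z * X a" by (simp add: sum.distrib resolvent_trace_def sum_distrib_left)
    finally have "(of_nat n + z * X a) * cnj (W a) = (\<Sum>i<n. \<Sum>k<n. entry a i k * G a k i) * cnj (W a)" by simp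
    also have "(\<Sum>i<n. \<Sum>k<n. entry a i k * G a k i)
        = (\<Sum>(i,j)\<in>upper_pairs n. 2 / goe_var (i,j) * (entry a i j * G a j i))"
    proof (rule sum_symmetric_eq_sum_upper_pairs)
      show "complex_of_real (entry a i j) * G a j i = entry a j i * G a i j" for i j
        unfolding resolvent_commute[of n z a i j] by (simp add: min.commute max.commute)
    qed
    also have "\<dots> * cnj (W a) = (\<Sum>(i,j)\<in>upper_pairs n. 2 / goe_var (i,j) * (a (i,j) *\<^sub>R F i j a))"
      unfolding sum_distrib_right
    proof (rule sum.cong[OF refl], clarify)
      fix i j :: nat assume "i \<le> j"
      then show "2 / goe_var (i,j) * (entry a i j * G a j i) * cnj (W a) = 2 / goe_var (i,j) * (a (i,j) *\<^sub>R F i j a)"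
        unfolding F_def resolvent_commute[of n z a j i] by (simp add: scaleR_conv_of_real)
    qed
    finally show ?thesis .
  qed
  have rhs: "(\<Sum>(i,j)\<in>upper_pairs n. 2 * F' i j a) = - ((X a)\<^sup>2 + (\<Sum>k<n. \<Sum>l<n. G a k l * G a k l)) * cnj (W a)
        - 4 * cnj (X a) * (\<Sum>k<n. \<Sum>l<n. G a k l * cnj (G2 a k l))" for a
  proof -
    have "(\<Sum>(i,j)\<in>upper_pairs n. 2 * F' i j a) = (\<Sum>(i,j)\<in>upper_pairs n. 2 / goe_var (i,j) * S a i j)"
      by (rule sum.cong[OF refl])
         (auto simp: F'_def S_def goe_var_def field_simps simp del: complex_cnj_add complex_cnj_power cnj_sum)
    also have "\<dots> = (\<Sum>i<n. \<Sum>j<n. S a i j)" by (rule sum_symmetric_eq_sum_upper_pairs[symmetric, OF symS])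
    also have "\<dots> = (\<Sum>i<n. \<Sum>j<n. - cnj (W a) * (G a i i * G a j j) + (- cnj (W a) * (G a i j * G a i j)
        + - 4 * cnj (X a) * (G a i j * cnj (G2 a i j))))"
      unfolding S_def
      by (intro sum.cong refl) (simp add: algebra_simps del: complex_cnj_add complex_cnj_power cnj_sum)
    also have "\<dots> = - cnj (W a) * (X a * X a) + (- cnj (W a) * (\<Sum>i<n. \<Sum>j<n. G a i j * G a i j)
        + - 4 * cnj (X a) * (\<Sum>i<n. \<Sum>j<n. G a i j * cnj (G2 a i j)))"
      unfolding sum.distrib sum_distrib_left[symmetric] resolvent_trace_def sum_distrib_right[symmetric] ..
    finally show ?thesis by (simp add: algebra_simps power2_eq_square del: complex_cnj_add complex_cnj_power cnj_sum)
  qed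
  let ?P = "\<lambda>a. (of_nat n + z * X a) * cnj (W a)"
  let ?T = "\<lambda>a. \<Sum>k<n. \<Sum>l<n. G a k l * G a k l"
  let ?V = "\<lambda>a. \<Sum>k<n. \<Sum>l<n. G a k l * cnj (G2 a k l)"
  let ?Q = "\<lambda>a. - ((X a)\<^sup>2 + ?T a) * cnj (W a) - 4 * cnj (X a) * ?V a"
  let ?R = "\<lambda>a. - (z * X a + ?T a) * cnj (W a) - 4 * cnj (X a) * ?V a"
  have smT: "goe_observable n ?T" by (intro goe_observable_sum goe_observable_mult goe_observable_resolvent z) auto
  have smV: "goe_observable n ?V"
    by (intro goe_observable_sum goe_observable_mult goe_observable_resolvent goe_observable_cnj z) auto
  have smP: "goe_observable n ?P"
    by (intro goe_observable_mult goe_observable_add goe_observable_cnj goe_observable_trace goe_observable_const goe_observable_W)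
  have smR: "goe_observable n ?R"
    unfolding diff_conv_add_uminus
    by (intro goe_observable_mult goe_observable_add goe_observable_cnj goe_observable_trace goe_observable_const goe_observable_W
      goe_observable_uminus smT smV)
  have smQ: "goe_observable n ?Q"
    unfolding diff_conv_add_uminus power2_eq_square
    by (intro goe_observable_mult goe_observable_add goe_observable_cnj goe_observable_trace goe_observable_const
      goe_observable_uminus smT smV)
  have sum_int: "(\<integral>a. (\<Sum>(i,j)\<in>upper_pairs n. c i j * f i j a) \<partial>goe n 1)
      = (\<Sum>(i,j)\<in>upper_pairs n. c i j * (\<integral>a. f i j a \<partial>goe n 1))"
    if "\<And>i j. (i,j) \<in> upper_pairs n \<Longrightarrow> integrable (goe n 1) (f i j)"
    for c :: "nat \<Rightarrow> nat \<Rightarrow> complex" and f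
    unfolding case_prod_unfold
    by (subst Bochner_Integration.integral_sum)
       (auto intro!: Bochner_Integration.integrable_mult_right that)
  have "(\<integral>a. ?P a \<partial>goe n 1) = (\<Sum>(i,j)\<in>upper_pairs n. 2 / goe_var (i,j) * (\<integral>a. a (i,j) *\<^sub>R F i j a \<partial>goe n 1))"
    unfolding lhs by (rule sum_int) (rule goe_integration_by_parts(1)[OF _ smF smF' D])
  also have "\<dots> = (\<Sum>(i,j)\<in>upper_pairs n. 2 * (\<integral>a. F' i j a \<partial>goe n 1))"
  proof (rule sum.cong[OF refl], clarify)
    fix i j assume "i \<le> j" "j < n"
    then have ij: "(i,j) \<in> upper_pairs n" by simp
    show "2 / goe_var (i,j) * (\<integral>a. a (i,j) *\<^sub>R F i j a \<partial>goe n 1) = 2 * (\<integral>a. F' i j a \<partial>goe n 1)"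
      unfolding goe_integration_by_parts(2)[OF ij smF[OF ij] smF'[OF ij] D[OF ij]]
      using goe_var_pos[of "(i,j)"] by (simp add: scaleR_conv_of_real)
  qed
  also have "\<dots> = (\<integral>a. ?Q a \<partial>goe n 1)"
    unfolding rhs[symmetric] by (rule sum_int[symmetric]) (rule goe_observable_integrable[OF smF'])
  finally have main: "(\<integral>a. ?P a \<partial>goe n 1) = (\<integral>a. ?Q a \<partial>goe n 1)" .
  have "W a * cnj (W a) = ?R a + (?P a - ?Q a)" for a
    by (simp add: algebra_simps del: complex_cnj_add complex_cnj_power cnj_sum)
  then have "(\<integral>a. W a * cnj (W a) \<partial>goe n 1) = (\<integral>a. ?R a + (?P a - ?Q a) \<partial>goe n 1)" by (simp only:)
  also have "\<dots> = (\<integral>a. ?R a \<partial>goe n 1) + ((\<integral>a. ?P a \<partial>goe n 1) - (\<integral>a. ?Q a \<partial>goe n 1))"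
    by (simp only: Bochner_Integration.integral_add Bochner_Integration.integral_diff Bochner_Integration.integrable_diff
      goe_observable_integrable[OF smR] goe_observable_integrable[OF smP] goe_observable_integrable[OF smQ])
  finally show ?thesis unfolding main by simp
qed

end

text \<open>Here \<open>x = |X|\<close> and \<open>w = |W|\<close>. The terms on the left are absorbed into a part of
  \<open>w\<^sup>2\<close> by completing squares, once for the product \<open>x w\<close> and once for the linear term in \<open>w\<close>
  that comes from the bound on \<open>x\<^sup>2\<close>.\<close>

lemma loop_remainder_arith:
  fixes x w C D N K :: real
  assumes "x\<^sup>2 \<le> w + N" "0 \<le> D" "w \<ge> 0" and K: "K = C\<^sup>2 + D"
  shows "C * x * w + D * x\<^sup>2 \<le> w\<^sup>2 / 2 + K\<^sup>2 + K * N"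
proof -
  have "C * x * w \<le> w\<^sup>2 / 4 + C\<^sup>2 * x\<^sup>2"
    using zero_le_power2[of "w / 2 - C * x"] by (simp add: power2_eq_square algebra_simps)
  then have "C * x * w + D * x\<^sup>2 \<le> w\<^sup>2 / 4 + K * x\<^sup>2" by (simp add: K algebra_simps)
  also have "K * x\<^sup>2 \<le> K * (w + N)" by (rule mult_left_mono) (use assms in auto)
  also have "K * w \<le> w\<^sup>2 / 4 + K\<^sup>2"
    using zero_le_power2[of "w / 2 - K"] by (simp add: power2_eq_square algebra_simps)
  then have "w\<^sup>2 / 4 + K * (w + N) \<le> w\<^sup>2 / 2 + K\<^sup>2 + K * N" by (simp add: algebra_simps)
  finally show ?thesis by simp
qed

text \<open>The loop equation and the trace bounds give \<open>E |W|\<^sup>2 \<le> E |W|\<^sup>2 / 2 + K\<^sup>2 + K n\<close>, so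
  \<open>E |W|\<^sup>2\<close> is at most of order \<open>n\<close>. In the factorization
  \<open>W = (X - i\<surd>n) (X + i\<surd>n)\<close> the second factor has absolute value at least \<open>\<surd>n\<close>, because the
  imaginary part of \<open>X\<close> is nonnegative.\<close>

lemma resolvent_trace_expectation:
  assumes z: "Im z > 0"
  shows "\<exists>B. \<forall>n\<ge>1. \<bar>(\<integral>a. Im (resolvent_trace n z a) \<partial>goe n 1) - sqrt (real n)\<bar> \<le> B"
proof -
  define C where "C = cmod z + 1 / Im z"
  define D where "D = 4 / (Im z)\<^sup>2"
  define K where "K = C\<^sup>2 + D"
  have CD: "C \<ge> 0" "D \<ge> 0" using z by (auto simp: C_def D_def)
  then have K0: "K \<ge> 0" by (simp add: K_def)
  have "\<bar>(\<integral>a. Im (resolvent_trace n z a) \<partial>goe n 1) - sqrt (real n)\<bar> \<le> 1 + (2 * K\<^sup>2 + 2 * K)" if n: "n \<ge> 1" for n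
  proof -
    interpret prob_space "goe n 1" by (rule prob_space_goe)
    let ?X = "resolvent_trace n z"
    let ?W = "\<lambda>a. (?X a)\<^sup>2 + of_nat n"
    let ?R = "\<lambda>a. - (z * ?X a + (\<Sum>k<n. \<Sum>l<n. resolvent n z a k l * resolvent n z a k l)) * cnj (?W a)
        - 4 * cnj (?X a) * (\<Sum>k<n. \<Sum>l<n. resolvent n z a k l * cnj (\<Sum>m<n. resolvent n z a k m * resolvent n z a m l))"
    have R_le: "cmod (?R a) \<le> (cmod (?W a))\<^sup>2 / 2 + (K\<^sup>2 + K * n)" for a
    proof -
      note b = resolvent_square_trace_bounds[OF z, of n a]
      have "cmod (?R a) \<le> (cmod z * cmod (?X a) + cmod (?X a) / Im z) * cmod (?W a)
          + 4 * cmod (?X a) * (cmod (?X a) / (Im z)\<^sup>2)"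
        unfolding diff_conv_add_uminus
        by (intro order_trans[OF norm_triangle_ineq] add_mono)
           (auto simp only: norm_mult norm_minus_cancel complex_mod_cnj norm_numeral
             intro!: mult_mono order_trans[OF norm_triangle_ineq] add_mono b order_refl norm_ge_zero add_nonneg_nonneg
               mult_nonneg_nonneg divide_nonneg_nonneg less_imp_le[OF z])
      also have "\<dots> = C * cmod (?X a) * cmod (?W a) + D * (cmod (?X a))\<^sup>2"
        by (simp add: C_def D_def power2_eq_square algebra_simps)
      also have "\<dots> \<le> (cmod (?W a))\<^sup>2 / 2 + K\<^sup>2 + K * n"
      proof (rule loop_remainder_arith[OF _ CD(2) norm_ge_zero K_def])
        have "(?X a)\<^sup>2 = ?W a - of_nat n" by simp
        then show "(cmod (?X a))\<^sup>2 \<le> cmod (?W a) + real n"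
          using norm_triangle_ineq4[of "?W a" "of_nat n"] by (metis norm_of_nat norm_power)
      qed
      finally show ?thesis by simp
    qed
    have smW: "goe_observable n (\<lambda>a. ?W a * cnj (?W a))"
      by (intro goe_observable_mult goe_observable_cnj goe_observable_W z)
    have WW: "?W a * cnj (?W a) = complex_of_real ((cmod (?W a))\<^sup>2)" for a
      by (rule complex_norm_square[symmetric])
    have iW: "integrable (goe n 1) (\<lambda>a. (cmod (?W a))\<^sup>2)"
      using integrable_Re[OF goe_observable_integrable[OF smW]] unfolding WW Re_complex_of_real .
    have "expectation (\<lambda>a. (cmod (?W a))\<^sup>2) = cmod (\<integral>a. ?W a * cnj (?W a) \<partial>goe n 1)"
      unfolding WW integral_complex_of_real norm_of_real by (simp add: integral_nonneg_AE)
    also have "\<dots> = cmod (\<integral>a. ?R a \<partial>goe n 1)" by (simp only: loop_equation[OF z])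
    also have "\<dots> \<le> expectation (\<lambda>a. cmod (?R a))" by (rule integral_norm_bound)
    also have "\<dots> \<le> expectation (\<lambda>a. (cmod (?W a))\<^sup>2 / 2 + (K\<^sup>2 + K * n))"
      by (rule integral_mono') (use R_le iW K0 in \<open>auto intro!: add_nonneg_nonneg\<close>)
    also have "\<dots> = expectation (\<lambda>a. (cmod (?W a))\<^sup>2) / 2 + (K\<^sup>2 + K * n)"
      using iW by (simp add: prob_space)
    finally have EW: "expectation (\<lambda>a. (cmod (?W a))\<^sup>2) \<le> 2 * K\<^sup>2 + 2 * K * n" by simp
    let ?Y = "\<lambda>a. ?X a - \<i> * sqrt n"
    have Y_le: "(cmod (?Y a))\<^sup>2 \<le> (cmod (?W a))\<^sup>2 / n" for a
    proof -
      have "?W a = ?Y a * (?X a + \<i> * sqrt n)"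
        by (simp add: algebra_simps power2_eq_square flip: of_real_mult)
      then have W: "(cmod (?W a))\<^sup>2 = (cmod (?Y a))\<^sup>2 * (cmod (?X a + \<i> * sqrt n))\<^sup>2"
        by (simp only: norm_mult power_mult_distrib)
      have "sqrt n \<le> Im (?X a + \<i> * sqrt n)" using resolvent_square_trace_bounds(1)[OF z] by simp
      also have "\<dots> \<le> cmod (?X a + \<i> * sqrt n)" by (rule order_trans[OF abs_ge_self abs_Im_le_cmod])
      finally have "(sqrt n)\<^sup>2 \<le> (cmod (?X a + \<i> * sqrt n))\<^sup>2" by (rule power_mono) simp
      then have "n * (cmod (?Y a))\<^sup>2 \<le> (cmod (?W a))\<^sup>2"
        unfolding W using mult_left_mono[of "real n" "(cmod (?X a + \<i> * sqrt n))\<^sup>2" "(cmod (?Y a))\<^sup>2"]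
        by (simp add: mult.commute)
      then show ?thesis using n by (simp add: field_simps)
    qed
    have smX: "goe_observable n ?X" by (rule goe_observable_trace[OF z])
    have iI: "integrable (goe n 1) (\<lambda>a. Im (?X a))"
      by (rule integrable_Im[OF goe_observable_integrable[OF smX]])
    have "\<bar>expectation (\<lambda>a. Im (?X a)) - sqrt n\<bar> = \<bar>expectation (\<lambda>a. Im (?X a) - sqrt n)\<bar>"
      using iI by (simp add: prob_space)
    also have "\<dots> \<le> expectation (\<lambda>a. \<bar>Im (?X a) - sqrt n\<bar>)" by (rule integral_abs_bound)
    also have "\<dots> \<le> expectation (\<lambda>a. 1 + (cmod (?W a))\<^sup>2 / n)"
    proof (rule integral_mono')
      show "integrable (goe n 1) (\<lambda>a. 1 + (cmod (?W a))\<^sup>2 / n)" using iW by simp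
      fix a
      have "\<bar>Im (?X a) - sqrt n\<bar> \<le> cmod (?Y a)" using abs_Im_le_cmod[of "?Y a"] by simp
      also have "\<dots> \<le> 1 + (cmod (?Y a))\<^sup>2"
      proof -
        have "2 * cmod (?Y a) \<le> (cmod (?Y a))\<^sup>2 + 1"
          using zero_le_power2[of "cmod (?Y a) - 1"] by (simp add: power2_diff)
        then show ?thesis using norm_ge_zero[of "?Y a"] by linarith
      qed
      also have "\<dots> \<le> 1 + (cmod (?W a))\<^sup>2 / n" using Y_le[of a] by simp
      finally show "\<bar>Im (?X a) - sqrt n\<bar> \<le> 1 + (cmod (?W a))\<^sup>2 / n" .
    qed simp
    also have "\<dots> = 1 + expectation (\<lambda>a. (cmod (?W a))\<^sup>2) / n" using iW by (simp add: prob_space)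
    also have "\<dots> \<le> 1 + (2 * K\<^sup>2 + 2 * K * n) / n" using EW n by (simp add: divide_right_mono)
    also have "\<dots> \<le> 1 + (2 * K\<^sup>2 + 2 * K)"
    proof -
      have "(2 * K\<^sup>2 + 2 * K * n) / n = 2 * K\<^sup>2 / n + 2 * K" using n by (simp add: field_simps)
      moreover have "2 * K\<^sup>2 / n \<le> 2 * K\<^sup>2 / 1" by (rule divide_left_mono) (use n in auto)
      ultimately show ?thesis by simp
    qed
    finally show ?thesis .
  qed
  then show ?thesis by blast
qed

section \<open>From Poisson integrals to integrals of rapidly decaying functions\<close>

text \<open>This is the Poisson kernel of the half plane without the factor \<open>1/\<pi>\<close>: its integral is \<open>\<pi>\<close>, and it is
  the imaginary part of \<open>1/(x - z)\<close> for \<open>z = c + i\<eta>\<close>.\<close>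

definition poisson :: "real \<Rightarrow> real \<Rightarrow> real \<Rightarrow> real" where
  "poisson c \<eta> x = \<eta> / ((x - c)\<^sup>2 + \<eta>\<^sup>2)"

lemma poisson_measurable [measurable]:
  "(\<lambda>p. poisson (fst p) \<eta> (snd p)) \<in> borel_measurable (borel \<Otimes>\<^sub>M borel)"
  "poisson c \<eta> \<in> borel_measurable borel" "(\<lambda>c. poisson c \<eta> x) \<in> borel_measurable borel"
  unfolding poisson_def by measurable

lemma poisson_nonneg: "\<eta> > 0 \<Longrightarrow> 0 \<le> poisson c \<eta> x"
  by (simp add: poisson_def)

lemma poisson_le: "\<eta> > 0 \<Longrightarrow> poisson c \<eta> x \<le> 1 / \<eta>"
proof -
  assume h: "\<eta> > 0"
  have "\<eta> / ((x - c)\<^sup>2 + \<eta>\<^sup>2) \<le> \<eta> / \<eta>\<^sup>2" by (rule divide_left_mono) (use h in \<open>auto intro!: mult_pos_pos add_nonneg_pos\<close>)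
  then show ?thesis using h by (simp add: poisson_def power2_eq_square)
qed

lemma poisson_times_square_le: "\<eta> > 0 \<Longrightarrow> poisson c \<eta> x * (c - x)\<^sup>2 \<le> \<eta>"
  by (simp add: poisson_def power2_commute[of c x] pos_divide_le_eq add_nonneg_pos mult_left_mono)

text \<open>This follows from \<open>1 + (c + u)\<^sup>2 \<le> 2 (1 + c\<^sup>2) (1 + u\<^sup>2)\<close>. It bounds all Poisson integrals of a
  positive measure by a single one.\<close>

lemma poisson_le_poisson_0_1:
  assumes "0 < \<eta>" "\<eta> \<le> 1"
  shows "poisson c \<eta> x \<le> 2 / \<eta> * (1 + c\<^sup>2) * poisson 0 1 x"
proof -
  let ?u = "x - c"
  have "1 + x\<^sup>2 \<le> 2 * (1 + c\<^sup>2) * (1 + ?u\<^sup>2)"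
  proof -
    have "1 + x\<^sup>2 \<le> 1 + x\<^sup>2 + (c - ?u)\<^sup>2 + 1 + 2 * (c * ?u)\<^sup>2" by simp
    also have "\<dots> = 2 * (1 + c\<^sup>2) * (1 + ?u\<^sup>2)" by (simp add: power2_eq_square algebra_simps)
    finally show ?thesis .
  qed
  also have "\<dots> \<le> 2 * (1 + c\<^sup>2) * ((?u\<^sup>2 + \<eta>\<^sup>2) / \<eta>\<^sup>2)"
  proof (rule mult_left_mono)
    have "?u\<^sup>2 * \<eta>\<^sup>2 \<le> ?u\<^sup>2 * 1" by (rule mult_left_mono) (use assms in \<open>auto simp: power_le_one\<close>)
    then show "1 + ?u\<^sup>2 \<le> (?u\<^sup>2 + \<eta>\<^sup>2) / \<eta>\<^sup>2" using assms by (simp add: field_simps)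
  qed simp
  finally have "(1 + x\<^sup>2) * \<eta>\<^sup>2 \<le> 2 * (1 + c\<^sup>2) * (?u\<^sup>2 + \<eta>\<^sup>2)"
    using assms by (simp add: pos_le_divide_eq)
  moreover have "?u\<^sup>2 + \<eta>\<^sup>2 > 0" "1 + x\<^sup>2 > 0" using assms by (auto intro: add_nonneg_pos add_pos_nonneg)
  moreover have "\<eta> / s \<le> 2 / \<eta> * K * (1 / y)" if "y * \<eta>\<^sup>2 \<le> 2 * K * s" "s > 0" "y > 0" for s y K
    using that assms by (simp add: field_simps power2_eq_square)
  ultimately have "\<eta> / (?u\<^sup>2 + \<eta>\<^sup>2) \<le> 2 / \<eta> * (1 + c\<^sup>2) * (1 / (1 + x\<^sup>2))" by blast
  then show ?thesis by (simp add: poisson_def add.commute)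
qed

lemma integrable_Cauchy_density: "integrable lborel (\<lambda>s::real. 1 / (1 + s\<^sup>2))"
  and integral_Cauchy_density: "(\<integral>s. 1 / (1 + s\<^sup>2) \<partial>lborel) = pi"
  using Sinc_Integral.integrable_inverse_1_plus_square LBINT_inverse_1_plus_square
  by (simp_all add: set_integrable_def interval_lebesgue_integral_def set_lebesgue_integral_def inverse_eq_divide)

lemma poisson_rescale:
  fixes g :: "real \<Rightarrow> real"
  assumes h: "\<eta> > 0"
  shows "(\<integral>c. poisson c \<eta> x * g (c - x) \<partial>lborel) = (\<integral>s. 1 / (1 + s\<^sup>2) * g (\<eta> * s) \<partial>lborel)"
    and "integrable lborel (\<lambda>s. 1 / (1 + s\<^sup>2) * g (\<eta> * s)) \<Longrightarrow> integrable lborel (\<lambda>c. poisson c \<eta> x * g (c - x))"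
proof -
  have eq: "\<eta> * (poisson (x + \<eta> * s) \<eta> x * g (x + \<eta> * s - x)) = 1 / (1 + s\<^sup>2) * g (\<eta> * s)" for s
  proof -
    have "\<eta> * \<eta> / ((x - (x + \<eta> * s))\<^sup>2 + \<eta>\<^sup>2) = (\<eta>\<^sup>2 * 1) / (\<eta>\<^sup>2 * (1 + s\<^sup>2))"
      by (simp add: power2_eq_square algebra_simps)
    also have "\<dots> = 1 / (1 + s\<^sup>2)" using h by simp
    finally have "\<eta> * poisson (x + \<eta> * s) \<eta> x = 1 / (1 + s\<^sup>2)"
      unfolding poisson_def times_divide_eq_right .
    then show ?thesis by (simp only: mult.assoc[symmetric] add_diff_cancel_left')
  qed
  show "(\<integral>c. poisson c \<eta> x * g (c - x) \<partial>lborel) = (\<integral>s. 1 / (1 + s\<^sup>2) * g (\<eta> * s) \<partial>lborel)"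
    using h unfolding eq[symmetric] by (subst lborel_integral_real_affine[of \<eta> _ x]) simp_all
  assume "integrable lborel (\<lambda>s. 1 / (1 + s\<^sup>2) * g (\<eta> * s))"
  then have "integrable lborel (\<lambda>s. \<eta> * (poisson (x + \<eta> * s) \<eta> x * g (x + \<eta> * s - x)))" unfolding eq .
  then have "integrable lborel (\<lambda>s. poisson (x + \<eta> * s) \<eta> x * g (x + \<eta> * s - x))"
    using h by (force dest!: integrable_mult_right[of "1 / \<eta>"])
  then show "integrable lborel (\<lambda>c. poisson c \<eta> x * g (c - x))"
    using h lborel_integrable_real_affine_iff[of \<eta> "\<lambda>c. poisson c \<eta> x * g (c - x)" x] by simp
qed

text \<open>The regularity is required of the product with \<open>1 + x\<^sup>2\<close> because the smoothing error
  has to be estimated in the supremum norm with this weight.\<close>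

definition weighted_Lipschitz :: "real \<Rightarrow> (real \<Rightarrow> complex) \<Rightarrow> bool" where
  "weighted_Lipschitz C h \<longleftrightarrow> h \<in> borel_measurable borel \<and> (\<forall>x. cmod (of_real (1 + x\<^sup>2) * h x) \<le> C) \<and>
     (\<forall>x y. cmod (of_real (1 + x\<^sup>2) * h x - of_real (1 + y\<^sup>2) * h y) \<le> C * \<bar>x - y\<bar>) \<and>
     integrable lborel (\<lambda>x. of_real (1 + x\<^sup>2) * h x)"

lemma weighted_Lipschitz_integrable:
  assumes "weighted_Lipschitz C h" shows "integrable lborel h"
proof (rule Bochner_Integration.integrable_bound[of _ "\<lambda>x. of_real (1 + x\<^sup>2) * h x"])
  show "AE x in lborel. norm (h x) \<le> norm (of_real (1 + x\<^sup>2) * h x)"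
  proof (rule AE_I2)
    fix x
    have "1 * cmod (h x) \<le> (1 + x\<^sup>2) * cmod (h x)" by (rule mult_right_mono) auto
    then show "cmod (h x) \<le> cmod (of_real (1 + x\<^sup>2) * h x)"
      by (simp add: norm_mult del: of_real_add of_real_power)
  qed
qed (use assms in \<open>auto simp: weighted_Lipschitz_def\<close>)

text \<open>The integral of \<open>min 1 |u|\<close> against the Poisson kernel of width \<open>\<eta>\<close>. The kernel has no first moment, which is
  why the truncation at 1 is needed.\<close>

definition smoothing_modulus :: "real \<Rightarrow> real" where
  "smoothing_modulus \<eta> = (\<integral>s. 1 / (1 + s\<^sup>2) * min 1 \<bar>\<eta> * s\<bar> \<partial>lborel)"

lemma integrable_smoothing_modulus: "integrable lborel (\<lambda>s::real. 1 / (1 + s\<^sup>2) * min 1 \<bar>\<eta> * s\<bar>)"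
proof (rule Bochner_Integration.integrable_bound[OF integrable_Cauchy_density])
  show "AE s in lborel. norm (1 / (1 + s\<^sup>2) * min 1 \<bar>\<eta> * s\<bar>) \<le> norm (1 / (1 + s\<^sup>2))"
    by (rule AE_I2) (auto simp: abs_mult divide_right_mono)
qed measurable

lemma smoothing_modulus_tendsto_0: "(\<lambda>k. smoothing_modulus (1 / real (Suc k))) \<longlonglongrightarrow> 0"
proof -
  have "(\<lambda>k. \<integral>s. 1 / (1 + s\<^sup>2) * min 1 \<bar>1 / real (Suc k) * s\<bar> \<partial>lborel) \<longlonglongrightarrow> (\<integral>s. 0 \<partial>(lborel :: real measure))"
  proof (rule integral_dominated_convergence[OF _ _ integrable_Cauchy_density])
    show "AE s in lborel. (\<lambda>k. 1 / (1 + s\<^sup>2) * min 1 \<bar>1 / real (Suc k) * s\<bar>) \<longlonglongrightarrow> 0"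
    proof (rule AE_I2)
      fix s :: real
      have "(\<lambda>k. 1 / (1 + s\<^sup>2) * min 1 \<bar>1 / real (Suc k) * s\<bar>) \<longlonglongrightarrow> 1 / (1 + s\<^sup>2) * min 1 \<bar>0 * s\<bar>"
        using lim_inverse_n' LIMSEQ_Suc[OF lim_inverse_n'] by (intro tendsto_intros) auto
      then show "(\<lambda>k. 1 / (1 + s\<^sup>2) * min 1 \<bar>1 / real (Suc k) * s\<bar>) \<longlonglongrightarrow> 0" by simp
    qed
    show "AE s in lborel. norm (1 / (1 + s\<^sup>2) * min 1 \<bar>1 / real (Suc k) * s\<bar>) \<le> 1 / (1 + s\<^sup>2)" for k
      by (rule AE_I2) (auto simp: abs_mult divide_right_mono)
  qed measurable
  then show ?thesis by (simp add: smoothing_modulus_def)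
qed

text \<open>Put \<open>H(x) = (1 + x\<^sup>2) h(x)\<close> and \<open>u = c - x\<close>. Then
  \<open>(1 + x\<^sup>2) (h(c) - h(x)) = (H(c) - H(x)) + (x\<^sup>2 - c\<^sup>2) h(c)\<close>. The first part is at most
  \<open>2 C min 1 |u|\<close>. In the second part, \<open>|x\<^sup>2 - c\<^sup>2| \<le> 2 |c| |u| + u\<^sup>2\<close> and \<open>|u| \<le> min 1 |u| + u\<^sup>2\<close>. The
  terms with \<open>u\<^sup>2\<close> are harmless since the kernel times \<open>u\<^sup>2\<close> is at most \<open>\<eta>\<close>, and \<open>H\<close> is integrable.\<close>

lemma poisson_smoothing_error:
  assumes h: "weighted_Lipschitz C h" and e: "0 < \<eta>"
  shows "(1 + x\<^sup>2) * cmod ((\<integral>c. poisson c \<eta> x *\<^sub>R h c \<partial>lborel) - pi *\<^sub>R h x)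
    \<le> 4 * C * smoothing_modulus \<eta> + 2 * \<eta> * (\<integral>c. cmod (of_real (1 + c\<^sup>2) * h c) \<partial>lborel)"
proof -
  let ?H = "\<lambda>x. of_real (1 + x\<^sup>2) * h x"
  let ?m = "\<lambda>u::real. min 1 \<bar>u\<bar>"
  have [measurable]: "h \<in> borel_measurable borel" using h by (simp add: weighted_Lipschitz_def)
  have Hle: "cmod (?H y) \<le> C" and HL: "cmod (?H y - ?H w) \<le> C * \<bar>y - w\<bar>" for y w
    using h by (auto simp: weighted_Lipschitz_def)
  have C: "C \<ge> 0" using order_trans[OF norm_ge_zero Hle] .
  have iH: "integrable lborel ?H" using h by (simp add: weighted_Lipschitz_def)
  have ih: "integrable lborel h" by (rule weighted_Lipschitz_integrable[OF h])
  have p1: "(\<integral>c. poisson c \<eta> x \<partial>lborel) = pi" "integrable lborel (\<lambda>c. poisson c \<eta> x)"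
    using poisson_rescale[OF e, where x = x and g = "\<lambda>_. 1"] integral_Cauchy_density integrable_Cauchy_density by auto
  have pm: "(\<integral>c. poisson c \<eta> x * ?m (c - x) \<partial>lborel) = smoothing_modulus \<eta>" "integrable lborel (\<lambda>c. poisson c \<eta> x * ?m (c - x))"
    using poisson_rescale[OF e, where x = x and g = ?m] integrable_smoothing_modulus[of \<eta>] by (auto simp: smoothing_modulus_def)
  have ip: "integrable lborel (\<lambda>c. poisson c \<eta> x *\<^sub>R h c)"
  proof (rule Bochner_Integration.integrable_bound[OF integrable_scaleR_right[OF ih, of "1 / \<eta>"]])
    show "AE c in lborel. norm (poisson c \<eta> x *\<^sub>R h c) \<le> norm ((1 / \<eta>) *\<^sub>R h c)"
      unfolding norm_scaleR using poisson_le[OF e] poisson_nonneg[OF e] e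
      by (intro AE_I2 mult_right_mono) auto
  qed measurable
  have ip2: "integrable lborel (\<lambda>c. poisson c \<eta> x *\<^sub>R h x)" using p1(2) by simp
  have "(\<integral>c. poisson c \<eta> x *\<^sub>R h c \<partial>lborel) - pi *\<^sub>R h x = (\<integral>c. poisson c \<eta> x *\<^sub>R (h c - h x) \<partial>lborel)"
    unfolding scaleR_diff_right Bochner_Integration.integral_diff[OF ip ip2] using p1 by simp
  then have "(1 + x\<^sup>2) * cmod ((\<integral>c. poisson c \<eta> x *\<^sub>R h c \<partial>lborel) - pi *\<^sub>R h x)
      = cmod (\<integral>c. (1 + x\<^sup>2) *\<^sub>R (poisson c \<eta> x *\<^sub>R (h c - h x)) \<partial>lborel)"
    unfolding integral_scaleR_right norm_scaleR by simp
  also have "\<dots> \<le> (\<integral>c. 4 * C * (poisson c \<eta> x * ?m (c - x)) + 2 * \<eta> * cmod (?H c) \<partial>lborel)"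
  proof (rule order_trans[OF integral_norm_bound], rule integral_mono')
    show "integrable lborel (\<lambda>c. 4 * C * (poisson c \<eta> x * ?m (c - x)) + 2 * \<eta> * cmod (?H c))"
      using pm(2) iH by (intro Bochner_Integration.integrable_add integrable_mult_right integrable_norm) auto
    fix c
    let ?u = "c - x"
    (* Trade |u|, which is not integrable against the kernel, for a bounded term and a quadratic one. *)
    have abs_le: "\<bar>?u\<bar> \<le> ?m ?u + ?u\<^sup>2"
    proof (cases "\<bar>?u\<bar> \<le> 1")
      case False
      then have "\<bar>?u\<bar> * 1 \<le> \<bar>?u\<bar> * \<bar>?u\<bar>" by (intro mult_left_mono) auto
      then show ?thesis by (simp add: power2_eq_square flip: abs_mult)
    qed simp
    have h_le: "(1 + c\<^sup>2) * cmod (h c) \<le> C" using Hle[of c] by (simp add: norm_mult del: of_real_add of_real_power)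
    have ch_le: "2 * \<bar>c\<bar> * cmod (h c) \<le> (1 + c\<^sup>2) * cmod (h c)"
    proof (rule mult_right_mono)
      show "2 * \<bar>c\<bar> \<le> 1 + c\<^sup>2" using zero_le_power2[of "\<bar>c\<bar> - 1"] by (simp add: power2_diff)
    qed simp
    have "(1 + x\<^sup>2) * cmod (h c - h x) = cmod (of_real (1 + x\<^sup>2) * (h c - h x))"
      by (simp add: norm_mult del: of_real_add of_real_power)
    also have "of_real (1 + x\<^sup>2) * (h c - h x) = (?H c - ?H x) + of_real (x\<^sup>2 - c\<^sup>2) * h c"
      by (simp add: algebra_simps)
    also have "cmod \<dots> \<le> 2 * C * ?m ?u + (2 * C * ?m ?u + 2 * ?u\<^sup>2 * cmod (?H c))"
    proof (rule norm_triangle_mono)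
      have "cmod (?H c - ?H x) \<le> 2 * C" using norm_triangle_ineq4[of "?H c" "?H x"] Hle[of c] Hle[of x] by linarith
      then show "cmod (?H c - ?H x) \<le> 2 * C * ?m ?u"
        using HL[of c x] mult_nonneg_nonneg[OF C abs_ge_zero[of ?u]] by (auto simp: min_def)
      have "\<bar>x\<^sup>2 - c\<^sup>2\<bar> = \<bar>?u\<bar> * \<bar>2 * c - ?u\<bar>"
        unfolding abs_mult[symmetric] by (subst abs_minus_commute) (simp add: power2_eq_square algebra_simps)
      also have "\<dots> \<le> \<bar>?u\<bar> * (2 * \<bar>c\<bar> + \<bar>?u\<bar>)" by (intro mult_left_mono) auto
      also have "\<dots> = 2 * \<bar>c\<bar> * \<bar>?u\<bar> + ?u\<^sup>2" by (simp add: algebra_simps power2_eq_square flip: abs_mult)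
      also have "\<dots> \<le> 2 * \<bar>c\<bar> * (?m ?u + ?u\<^sup>2) + ?u\<^sup>2"
        using mult_left_mono[OF abs_le, of "2 * \<bar>c\<bar>"] by simp
      finally have "\<bar>x\<^sup>2 - c\<^sup>2\<bar> * cmod (h c) \<le> (2 * \<bar>c\<bar> * (?m ?u + ?u\<^sup>2) + ?u\<^sup>2) * cmod (h c)"
        by (rule mult_right_mono) simp
      also have "\<dots> = (2 * \<bar>c\<bar> * cmod (h c)) * (?m ?u + ?u\<^sup>2) + ?u\<^sup>2 * cmod (h c)"
        by (simp add: algebra_simps)
      also have "\<dots> \<le> ((1 + c\<^sup>2) * cmod (h c)) * (?m ?u + ?u\<^sup>2) + ?u\<^sup>2 * ((1 + c\<^sup>2) * cmod (h c))"
      proof (intro add_mono mult_right_mono[OF ch_le] mult_left_mono)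
        show "cmod (h c) \<le> (1 + c\<^sup>2) * cmod (h c)" using mult_right_mono[of 1 "1 + c\<^sup>2" "cmod (h c)"] by simp
      qed auto
      also have "\<dots> = ((1 + c\<^sup>2) * cmod (h c)) * ?m ?u + 2 * ?u\<^sup>2 * ((1 + c\<^sup>2) * cmod (h c))"
        by (simp add: algebra_simps)
      also have "\<dots> \<le> 2 * C * ?m ?u + 2 * ?u\<^sup>2 * ((1 + c\<^sup>2) * cmod (h c))"
      proof -
        have "((1 + c\<^sup>2) * cmod (h c)) * ?m ?u \<le> C * ?m ?u" by (rule mult_right_mono[OF h_le]) simp
        moreover have "0 \<le> C * ?m ?u" using C by simp
        ultimately show ?thesis by linarith
      qed
      finally show "cmod (of_real (x\<^sup>2 - c\<^sup>2) * h c) \<le> 2 * C * ?m ?u + 2 * ?u\<^sup>2 * cmod (?H c)"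
        unfolding norm_mult norm_of_real by simp
    qed
    finally have "(1 + x\<^sup>2) * cmod (h c - h x) \<le> 4 * C * ?m ?u + 2 * ?u\<^sup>2 * cmod (?H c)" by simp
    from mult_left_mono[OF this poisson_nonneg[OF e, of c x]]
    have "poisson c \<eta> x * ((1 + x\<^sup>2) * cmod (h c - h x))
        \<le> 4 * C * (poisson c \<eta> x * ?m ?u) + 2 * (poisson c \<eta> x * ?u\<^sup>2) * cmod (?H c)"
      by (simp only: distrib_left mult_ac)
    also have "\<dots> \<le> 4 * C * (poisson c \<eta> x * ?m ?u) + 2 * \<eta> * cmod (?H c)"
      using mult_right_mono[OF poisson_times_square_le[OF e, of c x], of "2 * cmod (?H c)"]
      by (simp add: mult_ac del: of_real_add of_real_power)
    finally show "cmod ((1 + x\<^sup>2) *\<^sub>R (poisson c \<eta> x *\<^sub>R (h c - h x)))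
        \<le> 4 * C * (poisson c \<eta> x * ?m ?u) + 2 * \<eta> * cmod (?H c)"
      using poisson_nonneg[OF e, of c x] by (simp add: mult_ac del: of_real_add of_real_power)
    show "0 \<le> 4 * C * (poisson c \<eta> x * ?m ?u) + 2 * \<eta> * cmod (?H c)"
      using C e poisson_nonneg[OF e, of c x] by (intro add_nonneg_nonneg mult_nonneg_nonneg) auto
  qed
  also have "\<dots> = 4 * C * smoothing_modulus \<eta> + 2 * \<eta> * (\<integral>c. cmod (?H c) \<partial>lborel)"
    using pm iH by (subst Bochner_Integration.integral_add)
      (auto simp del: of_real_add of_real_power intro!: integrable_mult_right integrable_norm)
  finally show ?thesis .
qed

text \<open>For fixed \<open>\<eta>\<close>, Fubini turns the integral of the smoothed \<open>h\<close> against \<open>r\<^sub>N\<close> into the integral of \<open>h\<close>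
  against the Poisson integrals of \<open>r\<^sub>N\<close>, which converges by dominated convergence. The
  smoothing error is, uniformly in \<open>N\<close>, at most a quantity that vanishes with \<open>\<eta>\<close> times the Poisson
  integral of \<open>r\<^sub>N\<close> at height 1, which is bounded in \<open>N\<close>.\<close>

theorem tendsto_integral_of_poisson_limits:
  fixes r :: "nat \<Rightarrow> real \<Rightarrow> real"
  assumes ir: "\<And>N. integrable lborel (r N)" and r0: "\<And>N. AE x in lborel. 0 \<le> r N x"
    and P: "\<And>c \<eta>. \<eta> > 0 \<Longrightarrow> (\<lambda>N. \<integral>x. poisson c \<eta> x * r N x \<partial>lborel) \<longlonglongrightarrow> 1"
    and h: "weighted_Lipschitz C h"
  shows "(\<lambda>N. \<integral>x. r N x *\<^sub>R h x \<partial>lborel) \<longlonglongrightarrow> (1 / pi) *\<^sub>R (\<integral>x. h x \<partial>lborel)"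
proof -
  let ?P = "\<lambda>N c \<eta>. \<integral>x. poisson c \<eta> x * r N x \<partial>lborel"
  let ?H = "\<lambda>x. of_real (1 + x\<^sup>2) * h x"
  have [measurable]: "h \<in> borel_measurable borel" using h by (simp add: weighted_Lipschitz_def)
  have [measurable]: "r N \<in> borel_measurable borel" for N using borel_measurable_integrable[OF ir] by simp
  have ih: "integrable lborel h" by (rule weighted_Lipschitz_integrable[OF h])
  have iH: "integrable lborel ?H" using h by (simp add: weighted_Lipschitz_def)
  have C: "C \<ge> 0" using h order_trans[OF norm_ge_zero] unfolding weighted_Lipschitz_def by blast
  have ipr: "integrable lborel (\<lambda>x. poisson c \<eta> x * r N x)" if "\<eta> > 0" for c \<eta> N
  proof (rule Bochner_Integration.integrable_bound[OF integrable_mult_right[OF ir, of "1 / \<eta>" N]])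
    show "AE x in lborel. norm (poisson c \<eta> x * r N x) \<le> norm (1 / \<eta> * r N x)"
      unfolding norm_mult using poisson_le[OF that] poisson_nonneg[OF that] that
      by (intro AE_I2 mult_right_mono) auto
  qed measurable
  have P_nonneg: "0 \<le> ?P N c \<eta>" if "\<eta> > 0" for N c \<eta>
    by (rule integral_nonneg_AE) (use r0[of N] poisson_nonneg[OF that] in auto)
  (* Bound the masses of r N against 1 / (1 + x^2), uniformly in N. *)
  obtain B where B: "\<And>N. ?P N 0 1 \<le> B" "B > 0"
  proof -
    have "Bseq (\<lambda>N. ?P N 0 1)" using P[of 1 0] convergentI convergent_imp_Bseq by auto
    then obtain B where "B > 0" "\<And>N. norm (?P N 0 1) \<le> B" by (auto simp: Bseq_def)
    then show ?thesis using that by (metis abs_le_D1 real_norm_def)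
  qed
  define \<delta> where "\<delta> \<eta> = 4 * C * smoothing_modulus \<eta> + 2 * \<eta> * (\<integral>c. cmod (?H c) \<partial>lborel)" for \<eta>
  have approx: "cmod (pi *\<^sub>R (\<integral>x. r N x *\<^sub>R h x \<partial>lborel) - (\<integral>c. ?P N c \<eta> *\<^sub>R h c \<partial>lborel)) \<le> \<delta> \<eta> * B"
    if e: "\<eta> > 0" for N \<eta>
  proof -
    let ?f = "\<lambda>x c. (poisson c \<eta> x * r N x) *\<^sub>R h c"
    have m1 [measurable]: "(\<lambda>p. poisson (snd p) \<eta> (fst p)) \<in> borel_measurable (lborel \<Otimes>\<^sub>M lborel)"
      unfolding poisson_def by measurable
    have "integrable (lborel \<Otimes>\<^sub>M lborel) (\<lambda>p. r N (fst p) *\<^sub>R h (snd p))"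
      by (rule lborel_pair.Fubini_integrable) (use ir ih in auto)
    then have i2: "integrable (lborel \<Otimes>\<^sub>M lborel) (\<lambda>p. (1 / \<eta>) *\<^sub>R (r N (fst p) *\<^sub>R h (snd p)))"
      by (rule integrable_scaleR_right)
    have "integrable (lborel \<Otimes>\<^sub>M lborel) (\<lambda>p. (poisson (snd p) \<eta> (fst p) * r N (fst p)) *\<^sub>R h (snd p))"
    proof (rule Bochner_Integration.integrable_bound[OF i2])
      show "AE p in lborel \<Otimes>\<^sub>M lborel. norm ((poisson (snd p) \<eta> (fst p) * r N (fst p)) *\<^sub>R h (snd p))
          \<le> norm ((1 / \<eta>) *\<^sub>R (r N (fst p) *\<^sub>R h (snd p)))"
        unfolding norm_scaleR abs_mult mult.assoc using poisson_le[OF e] poisson_nonneg[OF e] e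
        by (intro AE_I2 mult_right_mono) auto
    qed measurable
    then have if2: "integrable (lborel \<Otimes>\<^sub>M lborel) (case_prod ?f)" by (simp add: case_prod_unfold)
    have "(\<integral>c. ?P N c \<eta> *\<^sub>R h c \<partial>lborel) = (\<integral>c. (\<integral>x. ?f x c \<partial>lborel) \<partial>lborel)"
      using ipr[OF e] by simp
    also have "\<dots> = (\<integral>x. (\<integral>c. ?f x c \<partial>lborel) \<partial>lborel)" by (rule lborel_pair.Fubini_integral[OF if2])
    also have "\<dots> = (\<integral>x. r N x *\<^sub>R (\<integral>c. poisson c \<eta> x *\<^sub>R h c \<partial>lborel) \<partial>lborel)"
    proof -
      have "?f x c = r N x *\<^sub>R (poisson c \<eta> x *\<^sub>R h c)" for x c by simp
      then show ?thesis by (simp only: integral_scaleR_right)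
    qed
    finally have eq: "(\<integral>c. ?P N c \<eta> *\<^sub>R h c \<partial>lborel) = (\<integral>x. r N x *\<^sub>R (\<integral>c. poisson c \<eta> x *\<^sub>R h c \<partial>lborel) \<partial>lborel)" .
    have isx: "integrable lborel (\<lambda>x. r N x *\<^sub>R (\<integral>c. poisson c \<eta> x *\<^sub>R h c \<partial>lborel))"
    proof -
      have "?f x c = r N x *\<^sub>R (poisson c \<eta> x *\<^sub>R h c)" for x c by simp
      then show ?thesis using lborel_pair.integrable_fst[OF if2] by (simp only: integral_scaleR_right)
    qed
    have irh: "integrable lborel (\<lambda>x. pi *\<^sub>R (r N x *\<^sub>R h x))"
    proof (rule Bochner_Integration.integrable_bound[OF integrable_mult_right[OF ir, of "pi * C" N]])
      show "AE x in lborel. norm (pi *\<^sub>R (r N x *\<^sub>R h x)) \<le> norm (pi * C * r N x)"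
      proof (rule AE_I2)
        fix x
        have "1 * cmod (h x) \<le> (1 + x\<^sup>2) * cmod (h x)" by (rule mult_right_mono) auto
        also have "\<dots> = cmod (?H x)" by (simp add: norm_mult del: of_real_add of_real_power)
        also have "\<dots> \<le> C" using h by (simp add: weighted_Lipschitz_def)
        finally have "pi * \<bar>r N x\<bar> * cmod (h x) \<le> pi * \<bar>r N x\<bar> * C" by (intro mult_left_mono) auto
        then show "norm (pi *\<^sub>R (r N x *\<^sub>R h x)) \<le> norm (pi * C * r N x)"
          using C by (simp add: abs_mult mult_ac)
      qed
    qed measurable
    have "pi *\<^sub>R (\<integral>x. r N x *\<^sub>R h x \<partial>lborel) - (\<integral>c. ?P N c \<eta> *\<^sub>R h c \<partial>lborel)
        = (\<integral>x. pi *\<^sub>R (r N x *\<^sub>R h x) - r N x *\<^sub>R (\<integral>c. poisson c \<eta> x *\<^sub>R h c \<partial>lborel) \<partial>lborel)"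
      unfolding eq Bochner_Integration.integral_diff[OF irh isx] by (simp only: integral_scaleR_right)
    also have "cmod \<dots> \<le> (\<integral>x. \<delta> \<eta> * (poisson 0 1 x * r N x) \<partial>lborel)"
    proof (rule order_trans[OF integral_norm_bound], rule integral_mono_AE)
      show "integrable lborel (\<lambda>x. norm (pi *\<^sub>R (r N x *\<^sub>R h x) - r N x *\<^sub>R (\<integral>c. poisson c \<eta> x *\<^sub>R h c \<partial>lborel)))"
        by (rule integrable_norm[OF Bochner_Integration.integrable_diff[OF irh isx]])
      show "integrable lborel (\<lambda>x. \<delta> \<eta> * (poisson 0 1 x * r N x))" using ipr by simp
      show "AE x in lborel. norm (pi *\<^sub>R (r N x *\<^sub>R h x) - r N x *\<^sub>R (\<integral>c. poisson c \<eta> x *\<^sub>R h c \<partial>lborel))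
          \<le> \<delta> \<eta> * (poisson 0 1 x * r N x)"
        using r0[of N]
      proof eventually_elim
        case (elim x)
        let ?D = "(\<integral>c. poisson c \<eta> x *\<^sub>R h c \<partial>lborel) - pi *\<^sub>R h x"
        have "cmod ?D * (1 + x\<^sup>2) \<le> \<delta> \<eta>"
          using poisson_smoothing_error[OF h e, of x] by (simp add: \<delta>_def mult.commute)
        then have "cmod ?D \<le> \<delta> \<eta> * poisson 0 1 x"
          by (simp add: poisson_def pos_le_divide_eq add_pos_nonneg add.commute)
        then have "r N x * cmod ?D \<le> r N x * (\<delta> \<eta> * poisson 0 1 x)" by (rule mult_left_mono[OF _ elim])
        moreover have "pi *\<^sub>R (r N x *\<^sub>R h x) - r N x *\<^sub>R (\<integral>c. poisson c \<eta> x *\<^sub>R h c \<partial>lborel) = - (r N x *\<^sub>R ?D)"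
          by (simp add: scaleR_diff_right mult.commute)
        ultimately show ?case using elim by (simp add: mult_ac)
      qed
    qed
    also have "\<dots> = \<delta> \<eta> * ?P N 0 1" by simp
    also have "\<dots> \<le> \<delta> \<eta> * B"
    proof (rule mult_left_mono[OF B(1)])
      have "smoothing_modulus \<eta> \<ge> 0" unfolding smoothing_modulus_def by (rule integral_nonneg_AE) simp
      then show "0 \<le> \<delta> \<eta>" unfolding \<delta>_def using C e by (intro add_nonneg_nonneg mult_nonneg_nonneg integral_nonneg_AE) auto
    qed
    finally show ?thesis .
  qed
  have limit: "(\<lambda>N. \<integral>c. ?P N c \<eta> *\<^sub>R h c \<partial>lborel) \<longlonglongrightarrow> (\<integral>c. h c \<partial>lborel)" if e: "0 < \<eta>" "\<eta> \<le> 1" for \<eta>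
  proof (rule integral_dominated_convergence[where w = "\<lambda>c. 2 / \<eta> * B * cmod (?H c)"])
    show "integrable lborel (\<lambda>c. 2 / \<eta> * B * cmod (?H c))"
      by (intro integrable_mult_right integrable_norm iH)
    show "(\<lambda>c. ?P N c \<eta> *\<^sub>R h c) \<in> borel_measurable lborel" for N
    proof -
      have [measurable]: "(\<lambda>p. poisson (fst p) \<eta> (snd p) * r N (snd p)) \<in> borel_measurable (lborel \<Otimes>\<^sub>M lborel)"
        unfolding poisson_def by measurable
      have "(\<lambda>c. ?P N c \<eta>) \<in> borel_measurable lborel"
        by (rule lborel.borel_measurable_lebesgue_integral) (simp add: case_prod_unfold)
      then show ?thesis by measurable
    qed
    show "AE c in lborel. (\<lambda>N. ?P N c \<eta> *\<^sub>R h c) \<longlonglongrightarrow> h c"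
      using tendsto_scaleR[OF P[OF e(1)] tendsto_const] by (intro AE_I2) simp
    fix N
    show "AE c in lborel. norm (?P N c \<eta> *\<^sub>R h c) \<le> 2 / \<eta> * B * cmod (?H c)"
    proof (rule AE_I2)
      fix c
      have "?P N c \<eta> \<le> (\<integral>x. 2 / \<eta> * (1 + c\<^sup>2) * (poisson 0 1 x * r N x) \<partial>lborel)"
      proof (rule integral_mono_AE)
        show "AE x in lborel. poisson c \<eta> x * r N x \<le> 2 / \<eta> * (1 + c\<^sup>2) * (poisson 0 1 x * r N x)"
          using r0[of N] unfolding mult.assoc[symmetric]
          by eventually_elim (rule mult_right_mono[OF poisson_le_poisson_0_1[OF e]])
      qed (use ipr e in auto)
      also have "\<dots> = 2 / \<eta> * (1 + c\<^sup>2) * ?P N 0 1" by simp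
      also have "\<dots> \<le> 2 / \<eta> * (1 + c\<^sup>2) * B" by (rule mult_left_mono[OF B(1)]) (use e in auto)
      finally have "?P N c \<eta> * cmod (h c) \<le> 2 / \<eta> * (1 + c\<^sup>2) * B * cmod (h c)" by (rule mult_right_mono) simp
      then show "norm (?P N c \<eta> *\<^sub>R h c) \<le> 2 / \<eta> * B * cmod (?H c)"
        using P_nonneg[OF e(1)] by (simp add: norm_mult mult_ac del: of_real_add of_real_power)
    qed
  qed measurable
  have "(\<lambda>k. \<delta> (1 / real (Suc k)) * B) \<longlonglongrightarrow> (4 * C * 0 + 2 * 0 * (\<integral>c. cmod (?H c) \<partial>lborel)) * B"
    unfolding \<delta>_def using LIMSEQ_Suc[OF lim_inverse_n'] by (intro tendsto_intros smoothing_modulus_tendsto_0) auto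
  then have \<delta>0: "(\<lambda>k. \<delta> (1 / real (Suc k)) * B) \<longlonglongrightarrow> 0" by simp
  have "(\<lambda>N. pi *\<^sub>R (\<integral>x. r N x *\<^sub>R h x \<partial>lborel)) \<longlonglongrightarrow> (\<integral>x. h x \<partial>lborel)"
  proof (rule LIMSEQ_I)
    fix \<epsilon> :: real assume "\<epsilon> > 0"
    then obtain k where k: "\<delta> (1 / real (Suc k)) * B < \<epsilon> / 2"
      using LIMSEQ_D[OF \<delta>0, of "\<epsilon> / 2"] by (force simp: abs_if split: if_splits)
    let ?e = "1 / real (Suc k)"
    have e: "0 < ?e" "?e \<le> 1" by auto
    obtain N0 where N0: "\<And>N. N \<ge> N0 \<Longrightarrow> cmod ((\<integral>c. ?P N c ?e *\<^sub>R h c \<partial>lborel) - (\<integral>c. h c \<partial>lborel)) < \<epsilon> / 2"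
      using LIMSEQ_D[OF limit[OF e], of "\<epsilon> / 2"] \<open>\<epsilon> > 0\<close> by auto
    have "cmod (pi *\<^sub>R (\<integral>x. r N x *\<^sub>R h x \<partial>lborel) - (\<integral>x. h x \<partial>lborel)) < \<epsilon>" if "N \<ge> N0" for N
      using norm_triangle_ineq[of "pi *\<^sub>R (\<integral>x. r N x *\<^sub>R h x \<partial>lborel) - (\<integral>c. ?P N c ?e *\<^sub>R h c \<partial>lborel)"
        "(\<integral>c. ?P N c ?e *\<^sub>R h c \<partial>lborel) - (\<integral>c. h c \<partial>lborel)"] approx[OF e(1), of N] N0[OF that] k
      unfolding diff_add_cancel add_diff_eq by linarith
    then show "\<exists>no. \<forall>N\<ge>no. norm (pi *\<^sub>R (\<integral>x. r N x *\<^sub>R h x \<partial>lborel) - (\<integral>x. h x \<partial>lborel)) < \<epsilon>" by blast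
  qed
  from tendsto_scaleR[OF tendsto_const[of "1 / pi"] this] show ?thesis by simp
qed

section \<open>The density of the orthogonal ensemble near the origin\<close>

lemma poisson_eq_Im_inverse:
  assumes "\<eta> > 0"
  shows "poisson c \<eta> x = Im (1 / (of_real x - Complex c \<eta>))"
  by (simp add: poisson_def Im_divide complex_norm power2_eq_square)

lemma goe_density_poisson:
  assumes d: "is_goe_density n 1 \<rho>" and e: "\<eta> > 0"
  shows "(\<integral>x. poisson c \<eta> x * \<rho> x \<partial>lborel) =
    1 / real n * (\<integral>a. Im (resolvent_trace n (Complex c \<eta>) a) \<partial>goe n 1)"
proof -
  have pos: "(x - c)\<^sup>2 + \<eta>\<^sup>2 \<noteq> 0" for x using e by (simp add: add_nonneg_eq_0_iff)
  have "continuous_on UNIV (poisson c \<eta>)"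
    unfolding poisson_def using pos by (intro continuous_intros) auto
  moreover have "bounded (range (poisson c \<eta>))"
    using poisson_le[OF e, of c] poisson_nonneg[OF e, of c] by (auto simp: bounded_iff intro!: exI[of _ "1 / \<eta>"])
  ultimately have 1: "(\<integral>x. poisson c \<eta> x * \<rho> x \<partial>lborel) =
    1 / real n * (\<integral>a. mat_trace (mat_fun (poisson c \<eta>) (sym_mat n a)) \<partial>goe n 1)"
    using d unfolding is_goe_density_def by blast
  have 2: "mat_trace (mat_fun (poisson c \<eta>) (sym_mat n a)) = Im (resolvent_trace n (Complex c \<eta>) a)" for a
    unfolding mat_trace_mat_fun poisson_eq_Im_inverse[OF e]
    unfolding resolvent_trace_eq Im_sum ..
  show ?thesis using 1 unfolding 2 .
qed

text \<open>The integral is the expectation of \<open>Im X / \<surd>n\<close>, so its distance from 1 is of order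
  \<open>1/\<surd>n\<close>.\<close>

lemma goe_poisson_limit:
  assumes d: "\<And>n. n \<ge> 1 \<Longrightarrow> is_goe_density n 1 (\<rho> n)" and e: "\<eta> > 0"
  shows "(\<lambda>n. \<integral>x. poisson c \<eta> x * (sqrt (real n) * \<rho> n x) \<partial>lborel) \<longlonglongrightarrow> 1"
proof -
  obtain B where B: "\<And>n. n \<ge> 1 \<Longrightarrow> \<bar>(\<integral>a. Im (resolvent_trace n (Complex c \<eta>) a) \<partial>goe n 1) - sqrt (real n)\<bar> \<le> B"
    using resolvent_trace_expectation[of "Complex c \<eta>"] e by auto
  have le: "\<bar>(\<integral>x. poisson c \<eta> x * (sqrt (real n) * \<rho> n x) \<partial>lborel) - 1\<bar> \<le> B / sqrt (real n)" if n: "n \<ge> 1" for n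
  proof -
    let ?E = "\<integral>a. Im (resolvent_trace n (Complex c \<eta>) a) \<partial>goe n 1"
    have "(\<integral>x. poisson c \<eta> x * (sqrt (real n) * \<rho> n x) \<partial>lborel) = sqrt (real n) * (1 / real n * ?E)"
      unfolding goe_density_poisson[OF d[OF n] e, symmetric] mult.left_commute[of _ "sqrt (real n)"]
      by (rule integral_mult_right_zero)
    also have "\<dots> - 1 = (?E - sqrt (real n)) / sqrt (real n)"
      using n by (simp add: field_simps flip: real_sqrt_mult)
    finally show ?thesis using B[OF n] n by (simp add: abs_divide divide_right_mono)
  qed
  have "(\<lambda>n. (\<integral>x. poisson c \<eta> x * (sqrt (real n) * \<rho> n x) \<partial>lborel) - 1) \<longlonglongrightarrow> 0"
  proof (rule Lim_null_comparison)
    show "\<forall>\<^sub>F n in sequentially. norm ((\<integral>x. poisson c \<eta> x * (sqrt (real n) * \<rho> n x) \<partial>lborel) - 1) \<le> B / sqrt (real n)"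
      using le by (auto simp: eventually_sequentially)
    show "(\<lambda>n. B / sqrt (real n)) \<longlonglongrightarrow> 0" by real_asymp
  qed
  then show ?thesis by (rule LIM_zero_cancel)
qed

section \<open>Modulated Gaussians as test functions\<close>

text \<open>Normalized integrals of these functions against \<open>\<rho>\<close> are the characteristic function of
  \<^term>\<open>sigma_one \<rho>\<close>.\<close>

definition gauss_wave :: "real \<Rightarrow> real \<Rightarrow> complex" where
  "gauss_wave t x = exp (- x\<^sup>2 / 4) *\<^sub>R iexp (t * x)"

text \<open>The constant comes from \<open>1 + x\<^sup>2 \<le> 16 exp (x\<^sup>2/16)\<close>.\<close>

lemma square_weight_bound: "(1 + x\<^sup>2)\<^sup>2 * exp (- x\<^sup>2 / 4) \<le> 256 * exp (- x\<^sup>2 / 8)" for x :: real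
proof -
  have "1 + x\<^sup>2 \<le> 16 * exp (x\<^sup>2 / 16)" using exp_ge_add_one_self[of "x\<^sup>2 / 16"] zero_le_power2[of x] by linarith
  then have "(1 + x\<^sup>2)\<^sup>2 \<le> (16 * exp (x\<^sup>2 / 16))\<^sup>2" by (rule power_mono) simp
  also have "\<dots> = 256 * exp (x\<^sup>2 / 8)" by (simp add: power_mult_distrib power2_eq_square mult_exp_exp)
  finally have "(1 + x\<^sup>2)\<^sup>2 * exp (- x\<^sup>2 / 4) \<le> 256 * exp (x\<^sup>2 / 8) * exp (- x\<^sup>2 / 4)" by (rule mult_right_mono) simp
  also have "\<dots> = 256 * exp (- x\<^sup>2 / 8)" by (simp add: mult.assoc mult_exp_exp)
  finally show ?thesis .
qed

lemma square_weight_bound': "(1 + x\<^sup>2)\<^sup>2 * exp (- x\<^sup>2 / 4) \<le> 256" for x :: real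
  by (rule order_trans[OF square_weight_bound]) simp

lemma norm_gauss_wave: "cmod (gauss_wave t x) = exp (- x\<^sup>2 / 4)"
  by (simp add: gauss_wave_def)

lemma one_plus_square_le: "1 + x\<^sup>2 \<le> (1 + x\<^sup>2)\<^sup>2" "\<bar>x\<bar> * (1 + x\<^sup>2) \<le> (1 + x\<^sup>2)\<^sup>2" "2 * \<bar>x\<bar> \<le> 1 + x\<^sup>2" for x :: real
proof -
  show 1: "2 * \<bar>x\<bar> \<le> 1 + x\<^sup>2" using zero_le_power2[of "\<bar>x\<bar> - 1"] by (simp add: power2_diff)
  have "1 * (1 + x\<^sup>2) \<le> (1 + x\<^sup>2) * (1 + x\<^sup>2)" by (rule mult_right_mono) auto
  then show "1 + x\<^sup>2 \<le> (1 + x\<^sup>2)\<^sup>2" by (simp add: power2_eq_square)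
  have "\<bar>x\<bar> * (1 + x\<^sup>2) \<le> (1 + x\<^sup>2) * (1 + x\<^sup>2)" using 1 abs_ge_zero[of x] by (intro mult_right_mono) auto
  then show "\<bar>x\<bar> * (1 + x\<^sup>2) \<le> (1 + x\<^sup>2)\<^sup>2" by (simp add: power2_eq_square)
qed

lemma integrable_exp_square: "integrable lborel (\<lambda>x::real. exp (- x\<^sup>2 / 8))"
proof -
  have "exp (- x\<^sup>2 / 8) = sqrt (2 * pi * 2\<^sup>2) * normal_density 0 2 x" for x
    by (simp add: normal_density_def)
  moreover have "integrable lborel (\<lambda>x. sqrt (2 * pi * 2\<^sup>2) * normal_density 0 2 x)" by simp
  ultimately show ?thesis by simp
qed

lemma gauss_wave_measurable [measurable]: "gauss_wave t \<in> borel_measurable borel"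
  unfolding gauss_wave_def[abs_def] by measurable

text \<open>The Lipschitz bound is the mean value inequality for the entire function
  \<open>(1 + z\<^sup>2) exp (i t z - z\<^sup>2/4)\<close> restricted to the real axis.\<close>

lemma weighted_Lipschitz_gauss_wave: "weighted_Lipschitz (256 * (2 + \<bar>t\<bar>)) (gauss_wave t)"
proof -
  let ?C = "256 * (2 + \<bar>t\<bar>)"
  let ?H = "\<lambda>x. of_real (1 + x\<^sup>2) * gauss_wave t x"
  define F where "F z = (1 + z\<^sup>2) * exp (\<i> * of_real t * z - z\<^sup>2 / 4)" for z :: complex
  define F' where "F' z = (2 * z + (1 + z\<^sup>2) * (\<i> * of_real t - z / 2)) * exp (\<i> * of_real t * z - z\<^sup>2 / 4)" for z :: complex
  have HF: "?H x = F (of_real x)" for x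
  proof -
    have "exp (\<i> * of_real t * of_real x - (of_real x)\<^sup>2 / 4) = iexp (t * x) * of_real (exp (- x\<^sup>2 / 4))"
      by (simp add: exp_of_real[symmetric] mult_exp_exp mult.assoc del: exp_of_real)
    then show ?thesis by (simp add: F_def gauss_wave_def scaleR_conv_of_real)
  qed
  have normH: "cmod (?H x) = (1 + x\<^sup>2) * exp (- x\<^sup>2 / 4)" for x
    by (simp add: norm_mult norm_gauss_wave del: of_real_add of_real_power)
  have HK: "cmod (?H x) \<le> 256 * exp (- x\<^sup>2 / 8)" for x
    unfolding normH
    by (rule order_trans[OF mult_right_mono[OF one_plus_square_le(1)] square_weight_bound]) simp
  have bound: "cmod (?H x) \<le> ?C" for x
  proof -
    have "cmod (?H x) \<le> 256 * 1" by (rule order_trans[OF HK]) simp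
    also have "256 * 1 \<le> ?C" by simp
    finally show ?thesis .
  qed
  have lip: "cmod (?H x - ?H y) \<le> ?C * \<bar>x - y\<bar>" for x y
  proof -
    have "cmod (F (of_real x) - F (of_real y)) \<le> ?C * cmod (of_real x - of_real y)"
    proof (rule field_differentiable_bound[OF convex_Reals, of F F'])
      show "(F has_field_derivative F' z) (at z within \<real>)" for z
        unfolding F_def[abs_def] F'_def
        by (auto intro!: derivative_eq_intros simp: algebra_simps)
      fix z :: complex assume "z \<in> \<real>"
      then obtain y where z: "z = of_real y" by (auto elim: Reals_cases)
      have E: "cmod (exp (\<i> * of_real t * z - z\<^sup>2 / 4)) = exp (- y\<^sup>2 / 4)"
        unfolding z norm_exp_eq_Re by (simp flip: of_real_power)
      have "cmod (2 * z + (1 + z\<^sup>2) * (\<i> * of_real t - z / 2)) \<le> 2 * \<bar>y\<bar> + (1 + y\<^sup>2) * (\<bar>t\<bar> + \<bar>y\<bar> / 2)"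
      proof (rule norm_triangle_mono)
        have "1 + z\<^sup>2 = of_real (1 + y\<^sup>2)" by (simp add: z)
        then have "cmod (1 + z\<^sup>2) = 1 + y\<^sup>2" by (simp only: norm_of_real) simp
        moreover have "cmod (\<i> * of_real t - z / 2) \<le> \<bar>t\<bar> + \<bar>y\<bar> / 2"
          using norm_triangle_ineq4[of "\<i> * of_real t" "z / 2"] by (simp add: z norm_mult norm_divide)
        ultimately show "cmod ((1 + z\<^sup>2) * (\<i> * of_real t - z / 2)) \<le> (1 + y\<^sup>2) * (\<bar>t\<bar> + \<bar>y\<bar> / 2)"
          unfolding norm_mult by (simp add: mult_left_mono)
      qed (simp add: z norm_mult)
      also have "\<dots> \<le> (2 + \<bar>t\<bar>) * (1 + y\<^sup>2)\<^sup>2"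
      proof -
        have "(1 + y\<^sup>2) * \<bar>t\<bar> \<le> (1 + y\<^sup>2)\<^sup>2 * \<bar>t\<bar>" by (rule mult_right_mono[OF one_plus_square_le(1)]) simp
        moreover have "2 * \<bar>y\<bar> + (1 + y\<^sup>2) * (\<bar>t\<bar> + \<bar>y\<bar> / 2) = 2 * \<bar>y\<bar> + (1 + y\<^sup>2) * \<bar>t\<bar> + \<bar>y\<bar> * (1 + y\<^sup>2) / 2"
          by (simp add: field_simps)
        moreover have "(2 + \<bar>t\<bar>) * (1 + y\<^sup>2)\<^sup>2 = 2 * (1 + y\<^sup>2)\<^sup>2 + (1 + y\<^sup>2)\<^sup>2 * \<bar>t\<bar>" by (simp only: distrib_right mult.commute)
        ultimately show ?thesis using one_plus_square_le[of y] zero_le_power2[of "1 + y\<^sup>2"] by linarith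
      qed
      finally have "cmod (F' z) \<le> (2 + \<bar>t\<bar>) * (1 + y\<^sup>2)\<^sup>2 * exp (- y\<^sup>2 / 4)"
        unfolding F'_def norm_mult[of _ "exp _"] E by (rule mult_right_mono) simp
      also have "\<dots> \<le> (2 + \<bar>t\<bar>) * 256"
        unfolding mult.assoc by (rule mult_left_mono[OF square_weight_bound']) simp
      finally show "cmod (F' z) \<le> ?C" by simp
    qed auto
    then show ?thesis unfolding HF by (simp flip: of_real_diff)
  qed
  have "integrable lborel ?H"
  proof (rule Bochner_Integration.integrable_bound[OF integrable_mult_right[OF integrable_exp_square, of 256]])
    show "AE x in lborel. norm (?H x) \<le> norm (256 * exp (- x\<^sup>2 / 8))"
      using HK by (intro AE_I2) simp
  qed measurable
  then show ?thesis using bound lip by (auto simp: weighted_Lipschitz_def)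
qed

text \<open>This controls the change of the frequency that is caused by the rescaling with the factor
  \<open>sqrt ((m+4)/(m+2))\<close>, in the form in which it can be integrated uniformly.\<close>

lemma gauss_wave_diff: "cmod (gauss_wave s x - gauss_wave t x) \<le> 256 * \<bar>s - t\<bar> * poisson 0 1 x"
proof -
  have "gauss_wave s x - gauss_wave t x = exp (- x\<^sup>2 / 4) *\<^sub>R (iexp (t * x) * (iexp ((s - t) * x) - 1))"
  proof -
    have "iexp (s * x) = iexp (t * x) * iexp ((s - t) * x)"
      by (simp add: mult_exp_exp algebra_simps)
    then have "iexp (s * x) - iexp (t * x) = iexp (t * x) * (iexp ((s - t) * x) - 1)"
      by (simp only: right_diff_distrib mult_1_right)
    then show ?thesis by (simp only: gauss_wave_def scaleR_diff_right[symmetric])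
  qed
  then have "cmod (gauss_wave s x - gauss_wave t x) = exp (- x\<^sup>2 / 4) * cmod (iexp ((s - t) * x) - 1)"
    by (simp add: norm_mult)
  also have "\<dots> \<le> exp (- x\<^sup>2 / 4) * \<bar>(s - t) * x\<bar>"
    using iexp_approx1[of "(s - t) * x" 0] by (intro mult_left_mono) auto
  finally have 1: "cmod (gauss_wave s x - gauss_wave t x) \<le> exp (- x\<^sup>2 / 4) * \<bar>(s - t) * x\<bar>" .
  have "exp (- x\<^sup>2 / 4) * \<bar>(s - t) * x\<bar> * (1 + x\<^sup>2) = \<bar>s - t\<bar> * (\<bar>x\<bar> * (1 + x\<^sup>2) * exp (- x\<^sup>2 / 4))"
    by (simp add: abs_mult)
  also have "\<dots> \<le> \<bar>s - t\<bar> * 256"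
    by (intro mult_left_mono order_trans[OF mult_right_mono[OF one_plus_square_le(2)] square_weight_bound']) auto
  finally have "exp (- x\<^sup>2 / 4) * \<bar>(s - t) * x\<bar> \<le> 256 * \<bar>s - t\<bar> * poisson 0 1 x"
    by (simp add: poisson_def pos_le_divide_eq add_pos_nonneg add.commute mult.commute)
  with 1 show ?thesis by linarith
qed

section \<open>Characteristic functions\<close>

lemma real_distribution_gaussian: "v \<ge> 0 \<Longrightarrow> real_distribution (gaussian v)"
  by (intro real_distribution.intro prob_space_gaussian real_distribution_axioms.intro) (auto simp: sets_gaussian)

lemma char_gaussian_2: "char (gaussian 2) t = (\<integral>x. gauss_wave t x \<partial>lborel) / (\<integral>x. gauss_wave 0 x \<partial>lborel)"
  and integral_gauss_wave_0: "(\<integral>x. gauss_wave 0 x \<partial>lborel) = of_real (sqrt (4 * pi))"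
proof -
  have nd: "normal_density 0 (sqrt 2) x = 1 / sqrt (4 * pi) * exp (- x\<^sup>2 / 4)" for x
    by (simp add: normal_density_def)
  have c: "char (gaussian 2) s = of_real (1 / sqrt (4 * pi)) * (\<integral>x. gauss_wave s x \<partial>lborel)" for s
  proof -
    have "char (gaussian 2) s = (\<integral>x. normal_density 0 (sqrt 2) x *\<^sub>R iexp (s * x) \<partial>lborel)"
      unfolding char_def by (rule gaussian_integral_pos) auto
    also have "\<dots> = (\<integral>x. (1 / sqrt (4 * pi)) *\<^sub>R gauss_wave s x \<partial>lborel)"
      unfolding nd gauss_wave_def scaleR_scaleR ..
    finally show ?thesis by (simp only: integral_scaleR_right) (simp only: scaleR_conv_of_real)
  qed
  interpret real_distribution "gaussian 2" by (rule real_distribution_gaussian) simp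
  show 0: "(\<integral>x. gauss_wave 0 x \<partial>lborel) = of_real (sqrt (4 * pi))"
    using c[of 0] char_zero by (simp add: field_simps)
  show "char (gaussian 2) t = (\<integral>x. gauss_wave t x \<partial>lborel) / (\<integral>x. gauss_wave 0 x \<partial>lborel)"
    unfolding 0 c[of t] by (simp add: field_simps)
qed

lemma char_gaussian_scale:
  assumes v: "v > 0"
  shows "char (gaussian v) t = char (gaussian 1) (sqrt v * t)"
proof -
  have nd: "sqrt v * normal_density 0 (sqrt v) (sqrt v * x) = normal_density 0 1 x" for x
    using v by (simp add: normal_density_def power_mult_distrib real_sqrt_mult field_simps)
  have "char (gaussian v) t = (\<integral>x. normal_density 0 (sqrt v) x *\<^sub>R iexp (t * x) \<partial>lborel)"
    unfolding char_def by (rule gaussian_integral_pos) (use v in auto)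
  also have "\<dots> = \<bar>sqrt v\<bar> *\<^sub>R (\<integral>x. normal_density 0 (sqrt v) (0 + sqrt v * x) *\<^sub>R iexp (t * (0 + sqrt v * x)) \<partial>lborel)"
    by (rule lborel_integral_real_affine) (use v in simp)
  also have "\<dots> = (\<integral>x. (sqrt v * normal_density 0 (sqrt v) (sqrt v * x)) *\<^sub>R iexp (sqrt v * t * x) \<partial>lborel)"
    unfolding integral_scaleR_right[symmetric] scaleR_scaleR using v by (simp add: mult_ac)
  also have "\<dots> = char (gaussian 1) (sqrt v * t)"
    unfolding nd char_def by (subst gaussian_integral_pos) auto
  finally show ?thesis .
qed

lemma char_gaussian_tendsto_1:
  assumes "v \<longlonglongrightarrow> 0" "\<And>k. v k > 0"
  shows "(\<lambda>k. char (gaussian (v k)) t) \<longlonglongrightarrow> 1"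
proof -
  interpret real_distribution "gaussian 1" by (rule real_distribution_gaussian) simp
  have "(\<lambda>k. sqrt (v k) * t) \<longlonglongrightarrow> sqrt 0 * t" by (intro tendsto_intros assms)
  then have "(\<lambda>k. sqrt (v k) * t) \<longlonglongrightarrow> 0" by simp
  from isCont_tendsto_compose[OF isCont_char this] show ?thesis
    unfolding char_gaussian_scale[OF assms(2)] char_zero .
qed

lemma char_convolution:
  assumes "real_distribution M" "real_distribution N"
  shows "char (convolution M N) t = char M t * char N t"
proof -
  interpret M: real_distribution M by fact
  interpret N: real_distribution N by fact
  interpret P: pair_prob_space M N ..
  have [measurable]: "(\<lambda>x. iexp (t * x)) \<in> borel_measurable borel" by measurable
  have i: "integrable (M \<Otimes>\<^sub>M N) (\<lambda>p. iexp (t * (fst p + snd p)))"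
    by (rule P.integrable_const_bound[of _ 1]) auto
  have "char (convolution M N) t = (\<integral>p. iexp (t * (fst p + snd p)) \<partial>(M \<Otimes>\<^sub>M N))"
    unfolding char_def convolution_def by (subst integral_distr) (auto simp: case_prod_unfold)
  also have "\<dots> = (\<integral>x. (\<integral>y. iexp (t * (x + y)) \<partial>N) \<partial>M)"
    using P.integral_fst'[OF i] by simp
  also have "\<dots> = (\<integral>x. iexp (t * x) * (\<integral>y. iexp (t * y) \<partial>N) \<partial>M)"
  proof -
    have "iexp (t * (x + y)) = iexp (t * x) * iexp (t * y)" for x y
      by (simp add: distrib_left exp_add)
    then show ?thesis by (simp only: integral_mult_right_zero)
  qed
  also have "\<dots> = char M t * char N t" by (simp only: integral_mult_left_zero char_def)
  finally show ?thesis .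
qed

lemma char_distr_scale:
  assumes "sets M = sets borel"
  shows "char (distr M borel (\<lambda>x. c * x)) t = char M (c * t)"
proof -
  have [measurable]: "(\<lambda>x. c * x) \<in> measurable M borel"
    by (subst measurable_cong_sets[OF assms refl]) measurable
  show ?thesis unfolding char_def by (subst integral_distr) (auto simp: mult_ac)
qed

text \<open>Negative values of the density are cut off by the conversion to extended nonnegative numbers. If
  the measure has total mass 1 nevertheless, then the density and its positive part have the same
  integral, so they agree almost everywhere.\<close>

lemma sigma_one_prob_space:
  assumes \<rho>: "integrable lborel \<rho>" and p: "prob_space (sigma_one \<rho>)"
  defines "Z \<equiv> \<integral>y. exp (- y\<^sup>2 / 4) * \<rho> y \<partial>lborel"
  shows "Z \<noteq> 0" and "AE x in lborel. 0 \<le> exp (- x\<^sup>2 / 4) * \<rho> x / Z"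
    and "integrable lborel (\<lambda>x. exp (- x\<^sup>2 / 4) * \<rho> x)"
proof -
  let ?w = "\<lambda>x. exp (- x\<^sup>2 / 4) * \<rho> x / Z"
  have [measurable]: "\<rho> \<in> borel_measurable borel" using borel_measurable_integrable[OF \<rho>] by simp
  show i: "integrable lborel (\<lambda>x. exp (- x\<^sup>2 / 4) * \<rho> x)"
  proof (rule Bochner_Integration.integrable_bound[OF \<rho>])
    show "AE x in lborel. norm (exp (- x\<^sup>2 / 4) * \<rho> x) \<le> norm (\<rho> x)"
      by (rule AE_I2) (simp add: abs_mult mult_left_le_one_le)
  qed measurable
  then have iw: "integrable lborel ?w" by simp
  then have im: "integrable lborel (\<lambda>x. max 0 (?w x))" by (intro integrable_max) auto
  have "emeasure (sigma_one \<rho>) (space (sigma_one \<rho>)) = 1" using p by (rule prob_space.emeasure_space_1)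
  then have "(\<integral>\<^sup>+x. ennreal (?w x) \<partial>lborel) = 1"
    unfolding sigma_one_def Z_def by (simp add: emeasure_density)
  also have "(\<integral>\<^sup>+x. ennreal (?w x) \<partial>lborel) = (\<integral>\<^sup>+x. ennreal (max 0 (?w x)) \<partial>lborel)"
    by (intro nn_integral_cong) (auto simp: max_def ennreal_neg)
  also have "\<dots> = ennreal (\<integral>x. max 0 (?w x) \<partial>lborel)"
    by (rule nn_integral_eq_integral[OF im]) simp
  finally have 1: "(\<integral>x. max 0 (?w x) \<partial>lborel) = 1" by simp
  show Z: "Z \<noteq> 0" using 1 by auto
  have "(\<integral>x. ?w x \<partial>lborel) = 1" using Z by (simp add: Z_def)
  then have "(\<integral>x. max 0 (?w x) - ?w x \<partial>lborel) = 0" using 1 im iw by simp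
  then have "AE x in lborel. max 0 (?w x) - ?w x = 0"
    by (subst (asm) integral_nonneg_eq_0_iff_AE) (use im iw in auto)
  then show "AE x in lborel. 0 \<le> ?w x" by eventually_elim linarith
qed

text \<open>The factor \<open>c\<close> cancels. With \<open>c = sqrt N\<close> the numerator and the denominator converge separately.\<close>

lemma char_sigma_one:
  assumes \<rho>: "integrable lborel \<rho>" and p: "prob_space (sigma_one \<rho>)" and c: "c \<noteq> 0"
  shows "char (sigma_one \<rho>) t =
    (\<integral>x. (c * \<rho> x) *\<^sub>R gauss_wave t x \<partial>lborel) / (\<integral>x. (c * \<rho> x) *\<^sub>R gauss_wave 0 x \<partial>lborel)"
proof -
  define Z where "Z = (\<integral>y. exp (- y\<^sup>2 / 4) * \<rho> y \<partial>lborel)"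
  note s = sigma_one_prob_space[OF \<rho> p, folded Z_def]
  have [measurable]: "\<rho> \<in> borel_measurable borel" using borel_measurable_integrable[OF \<rho>] by simp
  have "char (sigma_one \<rho>) t = (\<integral>x. (exp (- x\<^sup>2 / 4) * \<rho> x / Z) *\<^sub>R iexp (t * x) \<partial>lborel)"
    unfolding char_def sigma_one_def Z_def[symmetric] by (rule integral_density) (use s(2) in auto)
  also have "\<dots> = (\<integral>x. (1 / (c * Z)) *\<^sub>R ((c * \<rho> x) *\<^sub>R gauss_wave t x) \<partial>lborel)"
    using c by (intro Bochner_Integration.integral_cong refl) (simp add: gauss_wave_def)
  also have "\<dots> = (\<integral>x. (c * \<rho> x) *\<^sub>R gauss_wave t x \<partial>lborel) / of_real (c * Z)"
    unfolding integral_scaleR_right by (simp add: scaleR_conv_of_real)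
  also have "of_real (c * Z) = (\<integral>x. (c * \<rho> x) *\<^sub>R gauss_wave 0 x \<partial>lborel)"
  proof -
    have "(\<integral>x. (c * \<rho> x) *\<^sub>R gauss_wave 0 x \<partial>lborel) = (\<integral>x. complex_of_real (c * (exp (- x\<^sup>2 / 4) * \<rho> x)) \<partial>lborel)"
      by (intro Bochner_Integration.integral_cong refl) (simp add: gauss_wave_def scaleR_conv_of_real)
    also have "\<dots> = of_real (\<integral>x. c * (exp (- x\<^sup>2 / 4) * \<rho> x) \<partial>lborel)" by (rule integral_complex_of_real)
    finally show ?thesis by (simp add: Z_def)
  qed
  finally show ?thesis .
qed

section \<open>Convergence of the measures\<close>

theorem corollary1p5:
  fixes \<rho> :: "nat \<Rightarrow> real \<Rightarrow> real" and \<sigma> :: "nat \<Rightarrow> real measure"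
  assumes "\<And>N. N \<ge> 1 \<Longrightarrow> is_goe_density N 1 (\<rho> N)"
    and "\<And>m. m \<ge> 2 \<Longrightarrow> real_distribution (\<sigma> m)"
    and "\<And>m. m \<ge> 2 \<Longrightarrow>
      convolution (gaussian (2 / (real m + 2))) (\<sigma> m) =
      distr (sigma_one (\<rho> (m + 1))) borel (\<lambda>x. sqrt ((real m + 4) / (real m + 2)) * x)"
  shows "weak_conv_m \<sigma> (gaussian 2)"
proof -
  let ?c = "\<lambda>m. sqrt ((real m + 4) / (real m + 2))" and ?v = "\<lambda>m. 2 / (real m + 2)"
  (* r m plays the role of the normalized density, for matrices of size m + 1. *)
  define r where "r m x = sqrt (real (m + 1)) * \<rho> (m + 1) x" for m x
  have sets_s [simp]: "sets (sigma_one f) = sets borel" for f by (simp add: sigma_one_def)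
  have i\<rho>: "integrable lborel (\<rho> (m + 1))" for m using assms(1)[of "m + 1"] by (simp add: is_goe_density_def)
  then have ir: "integrable lborel (r m)" for m unfolding r_def[abs_def] by (rule integrable_mult_right)
  have P: "(\<lambda>m. \<integral>x. poisson c \<eta> x * r m x \<partial>lborel) \<longlonglongrightarrow> 1" if "\<eta> > 0" for c \<eta>
    using LIMSEQ_ignore_initial_segment[OF goe_poisson_limit[OF assms(1) that, of c], of 1] unfolding r_def .
  have prob: "prob_space (sigma_one (\<rho> (m + 1)))" if m: "m \<ge> 2" for m
  proof (rule prob_spaceI)
    interpret S: real_distribution "\<sigma> m" by (rule assms(2)[OF m])
    interpret G: real_distribution "gaussian (?v m)" by (rule real_distribution_gaussian) simp
    interpret GS: pair_prob_space "gaussian (?v m)" "\<sigma> m" ..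
    have "prob_space (convolution (gaussian (?v m)) (\<sigma> m))"
      unfolding convolution_def by (rule GS.prob_space_distr) measurable
    then have "emeasure (distr (sigma_one (\<rho> (m + 1))) borel (\<lambda>x. ?c m * x)) UNIV = 1"
      unfolding assms(3)[OF m] using prob_space.emeasure_space_1 by fastforce
    moreover have "(\<lambda>x. ?c m * x) \<in> measurable (sigma_one (\<rho> (m + 1))) borel"
      by (subst measurable_cong_sets[OF sets_s refl]) measurable
    ultimately show "emeasure (sigma_one (\<rho> (m + 1))) (space (sigma_one (\<rho> (m + 1)))) = 1"
      by (subst (asm) emeasure_distr) auto
  qed
  (* The density is known to have the sign of its normalizing constant. A Poisson integral, which is
     close to 1 for large m, decides that this sign is positive. *)
  have "\<forall>\<^sub>F m in sequentially. 0 < (\<integral>x. poisson 0 1 x * r m x \<partial>lborel)"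
    using order_tendstoD(1)[OF P[of 1 0], of 0] by simp
  then obtain M where M: "\<And>m. m \<ge> M \<Longrightarrow> 0 < (\<integral>x. poisson 0 1 x * r m x \<partial>lborel)"
    by (auto simp: eventually_sequentially)
  define K where "K = max M 2"
  have r0: "AE x in lborel. 0 \<le> r (k + K) x" for k
  proof -
    let ?m = "k + K"
    have m: "?m \<ge> 2" "?m \<ge> M" by (auto simp: K_def)
    define Z where "Z = (\<integral>y. exp (- y\<^sup>2 / 4) * \<rho> (?m + 1) y \<partial>lborel)"
    note s = sigma_one_prob_space[OF i\<rho> prob[OF m(1)], folded Z_def]
    have "Z > 0"
    proof (rule ccontr)
      assume "\<not> Z > 0"
      then have Z: "Z < 0" using s(1) by simp
      have "AE x in lborel. 0 \<le> - (poisson 0 1 x * r ?m x)"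
        using s(2)
      proof eventually_elim
        case (elim x)
        then have "\<rho> (?m + 1) x \<le> 0" using Z by (simp add: zero_le_divide_iff mult_le_0_iff)
        then show ?case using poisson_nonneg[of 1 0 x] by (simp add: r_def mult_nonneg_nonpos)
      qed
      then have "0 \<le> (\<integral>x. - (poisson 0 1 x * r ?m x) \<partial>lborel)" by (rule integral_nonneg_AE)
      then show False using M[OF m(2)] by simp
    qed
    show ?thesis using s(2)
    proof eventually_elim
      case (elim x)
      then show ?case using \<open>Z > 0\<close> by (simp add: r_def zero_le_divide_iff zero_le_mult_iff)
    qed
  qed
  have P': "(\<lambda>k. \<integral>x. poisson c \<eta> x * r (k + K) x \<partial>lborel) \<longlonglongrightarrow> 1" if "\<eta> > 0" for c \<eta>
    by (rule LIMSEQ_ignore_initial_segment[OF P[OF that]])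
  have wave: "(\<lambda>k. \<integral>x. r (k + K) x *\<^sub>R gauss_wave t x \<partial>lborel) \<longlonglongrightarrow> (1 / pi) *\<^sub>R (\<integral>x. gauss_wave t x \<partial>lborel)" for t
    by (rule tendsto_integral_of_poisson_limits[OF ir r0 P' weighted_Lipschitz_gauss_wave])
  have char_lim: "(\<lambda>k. char (\<sigma> (k + K)) t) \<longlonglongrightarrow> char (gaussian 2) t" for t
  proof -
    let ?t = "\<lambda>k. ?c (k + K) * t"
    have t_lim: "?t \<longlonglongrightarrow> t"
    proof -
      have "(\<lambda>m. ?c m) \<longlonglongrightarrow> 1" by real_asymp
      from tendsto_mult_right[OF LIMSEQ_ignore_initial_segment[OF this, of K], of t] show ?thesis by simp
    qed
    have [measurable]: "r m \<in> borel_measurable borel" for m using borel_measurable_integrable[OF ir] by simp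
    have iw: "integrable lborel (\<lambda>x. r m x *\<^sub>R gauss_wave s x)" for m s
    proof (rule Bochner_Integration.integrable_bound[OF ir[of m]])
      show "AE x in lborel. norm (r m x *\<^sub>R gauss_wave s x) \<le> norm (r m x)"
        by (rule AE_I2) (simp add: norm_gauss_wave mult_left_le)
    qed measurable
    have ip: "integrable lborel (\<lambda>x. poisson 0 1 x * r m x)" for m
    proof (rule Bochner_Integration.integrable_bound[OF ir[of m]])
      show "AE x in lborel. norm (poisson 0 1 x * r m x) \<le> norm (r m x)"
        using poisson_le[of 1 0] poisson_nonneg[of 1 0] by (intro AE_I2) (simp add: abs_mult mult_left_le_one_le)
    qed measurable
    let ?I = "\<lambda>k s. \<integral>x. r (k + K) x *\<^sub>R gauss_wave s x \<partial>lborel"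
    let ?P = "\<lambda>k. \<integral>x. poisson 0 1 x * r (k + K) x \<partial>lborel"
    have diff: "cmod (?I k (?t k) - ?I k t) \<le> 256 * \<bar>?t k - t\<bar> * ?P k" for k
    proof -
      have "cmod (?I k (?t k) - ?I k t)
          = cmod (\<integral>x. r (k + K) x *\<^sub>R gauss_wave (?t k) x - r (k + K) x *\<^sub>R gauss_wave t x \<partial>lborel)"
        unfolding Bochner_Integration.integral_diff[OF iw iw] ..
      also have "\<dots> \<le> (\<integral>x. 256 * \<bar>?t k - t\<bar> * (poisson 0 1 x * r (k + K) x) \<partial>lborel)"
      proof (rule order_trans[OF integral_norm_bound], rule integral_mono_AE)
        show "AE x in lborel. cmod (r (k + K) x *\<^sub>R gauss_wave (?t k) x - r (k + K) x *\<^sub>R gauss_wave t x)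
            \<le> 256 * \<bar>?t k - t\<bar> * (poisson 0 1 x * r (k + K) x)"
          using r0[of k]
        proof eventually_elim
          case (elim x)
          then show ?case
            using mult_left_mono[OF gauss_wave_diff[of "?t k" x t] elim]
            unfolding scaleR_diff_right[symmetric] norm_scaleR by (simp add: mult_ac)
        qed
      qed (use iw ip in auto)
      finally show ?thesis by simp
    qed
    have "(\<lambda>k. ?I k (?t k) - ?I k t) \<longlonglongrightarrow> 0"
    proof (rule Lim_null_comparison[OF always_eventually])
      have "(\<lambda>k. 256 * \<bar>?t k - t\<bar> * ?P k) \<longlonglongrightarrow> 256 * \<bar>t - t\<bar> * 1"
        by (intro tendsto_intros t_lim P') simp
      then show "(\<lambda>k. 256 * \<bar>?t k - t\<bar> * ?P k) \<longlonglongrightarrow> 0" by simp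
    qed (use diff in blast)
    from tendsto_add[OF this wave[of t]]
    have num: "(\<lambda>k. ?I k (?t k)) \<longlonglongrightarrow> (1 / pi) *\<^sub>R (\<integral>x. gauss_wave t x \<partial>lborel)" by simp
    have "((1 / pi) *\<^sub>R (\<integral>x. gauss_wave t x \<partial>lborel)) / ((1 / pi) *\<^sub>R (\<integral>x. gauss_wave 0 x \<partial>lborel))
        = char (gaussian 2) t"
      unfolding char_gaussian_2 by (simp add: scaleR_conv_of_real)
    moreover have "(\<lambda>k. ?I k (?t k) / ?I k 0) \<longlonglongrightarrow>
        ((1 / pi) *\<^sub>R (\<integral>x. gauss_wave t x \<partial>lborel)) / ((1 / pi) *\<^sub>R (\<integral>x. gauss_wave 0 x \<partial>lborel))"
      by (intro tendsto_divide num wave) (simp add: integral_gauss_wave_0)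
    ultimately have lim1: "(\<lambda>k. ?I k (?t k) / ?I k 0) \<longlonglongrightarrow> char (gaussian 2) t" by simp
    have lim2: "(\<lambda>k. char (gaussian (?v (k + K))) t) \<longlonglongrightarrow> 1"
    proof (rule char_gaussian_tendsto_1)
      have "(\<lambda>m. ?v m) \<longlonglongrightarrow> 0" by real_asymp
      then show "(\<lambda>k. ?v (k + K)) \<longlonglongrightarrow> 0" by (rule LIMSEQ_ignore_initial_segment)
    qed simp
    have eq: "char (gaussian (?v (k + K))) t * char (\<sigma> (k + K)) t = ?I k (?t k) / ?I k 0" for k
    proof -
      let ?m = "k + K"
      have m: "?m \<ge> 2" by (simp add: K_def)
      have "char (gaussian (?v ?m)) t * char (\<sigma> ?m) t = char (convolution (gaussian (?v ?m)) (\<sigma> ?m)) t"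
        by (rule char_convolution[symmetric, OF real_distribution_gaussian assms(2)[OF m]]) simp
      also have "\<dots> = char (sigma_one (\<rho> (?m + 1))) (?t k)"
        unfolding assms(3)[OF m] by (rule char_distr_scale) simp
      also have "\<dots> = ?I k (?t k) / ?I k 0"
        unfolding r_def by (rule char_sigma_one[OF i\<rho> prob[OF m]]) simp
      finally show ?thesis .
    qed
    have "(\<lambda>k. (?I k (?t k) / ?I k 0) / char (gaussian (?v (k + K))) t) \<longlonglongrightarrow> char (gaussian 2) t / 1"
      by (intro tendsto_divide lim1 lim2) simp
    moreover have "\<forall>\<^sub>F k in sequentially. (?I k (?t k) / ?I k 0) / char (gaussian (?v (k + K))) t = char (\<sigma> (k + K)) t"
      unfolding eq[symmetric] using tendsto_imp_eventually_ne[OF lim2, of 0]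
      by (auto elim!: eventually_mono)
    ultimately have "(\<lambda>k. char (\<sigma> (k + K)) t) \<longlonglongrightarrow> char (gaussian 2) t / 1"
      by (rule Lim_transform_eventually)
    then show ?thesis by simp
  qed
  have "weak_conv_m (\<lambda>k. \<sigma> (k + K)) (gaussian 2)"
    by (rule levy_continuity[OF assms(2) real_distribution_gaussian char_lim]) (auto simp: K_def)
  then show ?thesis
    unfolding weak_conv_m_def weak_conv_def by (auto intro: LIMSEQ_offset[where k = K])
qed

end
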